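(* An object of $\mathcal{C}$ lies in $\mathrm{add}\,\mathcal{T}$ if and only if its support is empty. The support of an object of $\mathcal{C}$ is finite if and only if the object lies in $\mathcal{X}$.
   Context: Fix a field $K$. All categories are $K$-linear Krull–Schmidt categories: every object is a finite formal direct sum of indecomposable objects with local endomorphism rings. The category $\mathcal{B}$ has indecomposable objects the pairs $(x,y)\in\mathbb{R}^2$, with $\mathrm{Hom}_{\mathcal{B}}((x,y),(x',y'))=K$ if $x\le x'$ and $y\le y'$, and $0$ otherwise; composition is multiplication of scalars; the morphism corresponding to $1\in K$ is the basic morphism. Let $\mathcal{B}_\pi$ be the full additive subcategory generated by all $(x,y)$ with $|y-x|\ge\pi$. The continuous derived category $\mathcal{D}$ is the full additive subcategory of $\mathcal{B}/\mathcal{B}_\pi$ (quotient by the ideal of morphisms factoring through objects of $\mathcal{B}_\pi$) generated by the $(x,y)$ with $|y-x|<\pi$. The doubled category $\mathcal{D}^{(2)}$ is obtained by adding a second copy $(x,y)'$ of every indecomposable $(x,y)$ together with an isomorphism $\eta:(x,y)'\cong(x,y)$; put $(x,y)''=(x,y)$. Let $F$ be the automorphism of $\mathcal{D}^{(2)}$ given on objects by $F(x,y)=(y+\pi,x+\pi)'$, taking basic morphisms to basic morphisms. The continuous cluster category $\mathcal{C}=\mathcal{C}_\pi$ is the orbit category $\mathcal{D}^{(2)}/F$, with $\mathrm{Hom}_{\mathcal{C}}(X,Y)=\bigoplus_{k\in\mathbb{Z}}\mathrm{Hom}_{\mathcal{D}^{(2)}}(X,F^kY)$. The orbit of $(x,y)$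 is denoted $M(x,y)$ (and that of $(x,y)'$ is $M(x,y)'\cong M(x,y)$), so $M(x,y)=M(y+\pi,x+\pi)'$. The standard cluster $\mathcal{T}$ is the set of objects $M\left(\frac{m\pi}{2^n},\pi+\frac{(m-1)\pi}{2^n}\right)$ for integers $n\ge0$, $0\le m<2^{n+1}$ (omitting $(\pi,\pi)$, which repeats $(0,0)$); $\mathrm{add}\,\mathcal{T}$ is the class of finite direct sums of objects of $\mathcal{T}$, up to isomorphism. The category $\mathcal{X}$ is the additive full subcategory of $\mathcal{C}$ (closed under isomorphism) generated by the rational objects, i.e. those obtained from $\mathcal{T}$ by finitely many mutations; equivalently the objects with coordinates $(a\pi/2^n,b\pi/2^n)$ for integers $a,b,n$ with $n\ge0$ and $|a-b|<2^n$. The support of an indecomposable object $X$ of $\mathcal{C}$ is the set of all $S\in\mathcal{T}$ not isomorphic to $X$ such that $\mathrm{Hom}_{\mathcal{C}}(S,X)\ne0$ and $\mathrm{Hom}_{\mathcal{C}}(X,S)\ne0$. The support of an arbitrary object is the union of the supports of its indecomposable components. *)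

theory Defs
  imports Complex_Main
begin

text \<open>
  Linear categories over a field \<open>'k\<close> are given by explicit data on a type \<open>'o\<close> of objects and a type
  \<open>'m\<close> of morphisms. Hom sets at different pairs of objects may overlap as sets (in the first category
  below every morphism is just a scalar), so the operations take the objects involved as arguments:
  \<open>Comp C X Y Z g f\<close> is the composite of \<open>f : X \<rightarrow> Y\<close> and \<open>g : Y \<rightarrow> Z\<close>. Values of the operations
  outside the object and hom sets carry no meaning.
\<close>

record ('o, 'k, 'm) lincat =
  Obj :: "'o set"
  Hom :: "'o \<Rightarrow> 'o \<Rightarrow> 'm set"
  Zero :: "'o \<Rightarrow> 'o \<Rightarrow> 'm"
  Add :: "'o \<Rightarrow> 'o \<Rightarrow> 'm \<Rightarrow> 'm \<Rightarrow> 'm"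
  Scale :: "'o \<Rightarrow> 'o \<Rightarrow> 'k \<Rightarrow> 'm \<Rightarrow> 'm"
  Ident :: "'o \<Rightarrow> 'm"
  Comp :: "'o \<Rightarrow> 'o \<Rightarrow> 'o \<Rightarrow> 'm \<Rightarrow> 'm \<Rightarrow> 'm"

definition isomorphic :: "('o, 'k, 'm) lincat \<Rightarrow> 'o \<Rightarrow> 'o \<Rightarrow> bool" where
  "isomorphic C X Y \<longleftrightarrow> X \<in> Obj C \<and> Y \<in> Obj C \<and>
     (\<exists>f\<in>Hom C X Y. \<exists>g\<in>Hom C Y X.
        Comp C X Y X g f = Ident C X \<and> Comp C Y X Y f g = Ident C Y)"

definition hom_nonzero :: "('o, 'k, 'm) lincat \<Rightarrow> 'o \<Rightarrow> 'o \<Rightarrow> bool" where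
  "hom_nonzero C X Y \<longleftrightarrow> Hom C X Y \<noteq> {Zero C X Y}"

definition full_subcat :: "('o, 'k, 'm) lincat \<Rightarrow> 'o set \<Rightarrow> ('o, 'k, 'm) lincat" where
  "full_subcat C P = C\<lparr>Obj := Obj C \<inter> P\<rparr>"

definition msum :: "('o, 'k, 'm) lincat \<Rightarrow> 'o \<Rightarrow> 'o \<Rightarrow> 'm list \<Rightarrow> 'm" where
  "msum C X Y fs = foldr (Add C X Y) fs (Zero C X Y)"


section \<open>Formal direct sums\<close>

text \<open>
  The additive closure of a linear category: an object is a list of objects, read as their formal
  direct sum, and a morphism is a matrix, stored as the list of its rows; the entry in row \<open>j\<close> and
  column \<open>i\<close> is the component from the \<open>i\<close>-th summand of the source to the \<open>j\<close>-th summand of the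
  target.
\<close>

definition mat :: "nat \<Rightarrow> nat \<Rightarrow> (nat \<Rightarrow> nat \<Rightarrow> 'm) \<Rightarrow> 'm list list" where
  "mat r c e = map (\<lambda>j. map (\<lambda>i. e j i) [0..<c]) [0..<r]"

definition additive_closure :: "('o, 'k, 'm) lincat \<Rightarrow> ('o list, 'k, 'm list list) lincat" where
  "additive_closure C =
    \<lparr> Obj = {Xs. set Xs \<subseteq> Obj C},
      Hom = (\<lambda>Xs Ys. {A. length A = length Ys \<and> (\<forall>j<length Ys. length (A ! j) = length Xs \<and>
               (\<forall>i<length Xs. A ! j ! i \<in> Hom C (Xs ! i) (Ys ! j)))}),
      Zero = (\<lambda>Xs Ys. mat (length Ys) (length Xs) (\<lambda>j i. Zero C (Xs ! i) (Ys ! j))),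
      Add = (\<lambda>Xs Ys A B. mat (length Ys) (length Xs)
               (\<lambda>j i. Add C (Xs ! i) (Ys ! j) (A ! j ! i) (B ! j ! i))),
      Scale = (\<lambda>Xs Ys c A. mat (length Ys) (length Xs)
               (\<lambda>j i. Scale C (Xs ! i) (Ys ! j) c (A ! j ! i))),
      Ident = (\<lambda>Xs. mat (length Xs) (length Xs)
               (\<lambda>j i. if i = j then Ident C (Xs ! i) else Zero C (Xs ! i) (Xs ! j))),
      Comp = (\<lambda>Xs Ys Zs B A. mat (length Zs) (length Xs)
               (\<lambda>j i. msum C (Xs ! i) (Zs ! j)
                  (map (\<lambda>k. Comp C (Xs ! i) (Ys ! k) (Zs ! j) (B ! j ! k) (A ! k ! i))
                     [0..<length Ys]))) \<rparr>"

definition add_generated :: "('o, 'k, 'm) lincat \<Rightarrow> 'o set \<Rightarrow> 'o list set" where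
  "add_generated C S =
     {Xs. \<exists>Ys. set Ys \<subseteq> S \<and> isomorphic (additive_closure C) Xs Ys}"


section \<open>Quotient by the ideal of morphisms factoring through given objects\<close>

text \<open>
  A morphism factors through a formal direct sum \<open>Z\<^sub>1 \<oplus> \<dots> \<oplus> Z\<^sub>n\<close> iff it is a row times a column, that
  is, a sum of composites through the \<open>Z\<^sub>i\<close>. Morphisms of the quotient category are cosets of the ideal.
\<close>

definition factor_ideal :: "('o, 'k, 'm) lincat \<Rightarrow> 'o set \<Rightarrow> 'o \<Rightarrow> 'o \<Rightarrow> 'm set" where
  "factor_ideal C P X Y =
     {msum C X Y (map (\<lambda>(Z, g, h). Comp C X Z Y g h) ps) |ps.
        \<forall>(Z, g, h)\<in>set ps. Z \<in> P \<and> h \<in> Hom C X Z \<and> g \<in> Hom C Z Y}"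

definition ideal_coset :: "('o, 'k, 'm) lincat \<Rightarrow> 'o set \<Rightarrow> 'o \<Rightarrow> 'o \<Rightarrow> 'm \<Rightarrow> 'm set" where
  "ideal_coset C P X Y f = Add C X Y f ` factor_ideal C P X Y"

definition quotient_cat :: "('o, 'k, 'm) lincat \<Rightarrow> 'o set \<Rightarrow> ('o, 'k, 'm set) lincat" where
  "quotient_cat C P =
    \<lparr> Obj = Obj C,
      Hom = (\<lambda>X Y. ideal_coset C P X Y ` Hom C X Y),
      Zero = (\<lambda>X Y. ideal_coset C P X Y (Zero C X Y)),
      Add = (\<lambda>X Y A B. \<Union>a\<in>A. \<Union>b\<in>B. ideal_coset C P X Y (Add C X Y a b)),
      Scale = (\<lambda>X Y c A. \<Union>a\<in>A. ideal_coset C P X Y (Scale C X Y c a)),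
      Ident = (\<lambda>X. ideal_coset C P X X (Ident C X)),
      Comp = (\<lambda>X Y Z B A. \<Union>b\<in>B. \<Union>a\<in>A. ideal_coset C P X Z (Comp C X Y Z b a)) \<rparr>"


section \<open>Doubled categories\<close>

text \<open>
  \<open>(X, False)\<close> is the object \<open>X\<close> itself and \<open>(X, True)\<close> its second copy \<open>X'\<close>. The isomorphism
  \<open>\<eta> : X' \<cong> X\<close> is \<open>Ident C X\<close>, regarded as a morphism from \<open>(X, True)\<close> to \<open>(X, False)\<close>.
\<close>

definition doubled_cat :: "('o, 'k, 'm) lincat \<Rightarrow> ('o \<times> bool, 'k, 'm) lincat" where
  "doubled_cat C =
    \<lparr> Obj = Obj C \<times> UNIV,
      Hom = (\<lambda>X Y. Hom C (fst X) (fst Y)),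
      Zero = (\<lambda>X Y. Zero C (fst X) (fst Y)),
      Add = (\<lambda>X Y. Add C (fst X) (fst Y)),
      Scale = (\<lambda>X Y. Scale C (fst X) (fst Y)),
      Ident = (\<lambda>X. Ident C (fst X)),
      Comp = (\<lambda>X Y Z. Comp C (fst X) (fst Y) (fst Z)) \<rparr>"


section \<open>Orbit categories\<close>

record ('o, 'm) lfunctor =
  omap :: "'o \<Rightarrow> 'o"
  mmap :: "'o \<Rightarrow> 'o \<Rightarrow> 'm \<Rightarrow> 'm"

definition inverse_functor ::
    "('o, 'k, 'm) lincat \<Rightarrow> ('o, 'm) lfunctor \<Rightarrow> ('o, 'm) lfunctor" where
  "inverse_functor C F =
     (let G = inv_into (Obj C) (omap F)
      in \<lparr> omap = G, mmap = (\<lambda>X Y. inv_into (Hom C (G X) (G Y)) (mmap F (G X) (G Y))) \<rparr>)"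

fun functor_power :: "('o, 'm) lfunctor \<Rightarrow> nat \<Rightarrow> ('o, 'm) lfunctor" where
  "functor_power F 0 = \<lparr> omap = (\<lambda>X. X), mmap = (\<lambda>X Y f. f) \<rparr>"
| "functor_power F (Suc n) =
     (let G = functor_power F n
      in \<lparr> omap = (\<lambda>X. omap F (omap G X)),
           mmap = (\<lambda>X Y f. mmap F (omap G X) (omap G Y) (mmap G X Y f)) \<rparr>)"

definition functor_int_power ::
    "('o, 'k, 'm) lincat \<Rightarrow> ('o, 'm) lfunctor \<Rightarrow> int \<Rightarrow> ('o, 'm) lfunctor" where
  "functor_int_power C F k =
     (if 0 \<le> k then functor_power F (nat k) else functor_power (inverse_functor C F) (nat (- k)))"

definition orbit_of :: "('o \<Rightarrow> 'o) \<Rightarrow> 'o \<Rightarrow> 'o set" where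
  "orbit_of \<phi> X = {Y. \<exists>n. (\<phi> ^^ n) X = Y \<or> (\<phi> ^^ n) Y = X}"

definition orbit_rep :: "'o set \<Rightarrow> 'o" where
  "orbit_rep U = (SOME X. X \<in> U)"

text \<open>
  The objects are the orbits of \<open>F\<close>. A morphism between the orbits of \<open>X\<close> and \<open>Y\<close> is a finitely
  supported family of \<open>f\<^sub>k : X \<rightarrow> F\<^sup>k Y\<close>, where \<open>X\<close> and \<open>Y\<close> are fixed representatives of their orbits,
  and the composite of such an \<open>f\<close> with \<open>g\<^sub>l : Y \<rightarrow> F\<^sup>l Z\<close> has \<open>n\<close>-th component
  \<open>\<Sum>\<^sub>k F\<^sup>k(g\<^sub>n\<^sub>-\<^sub>k) \<circ> f\<^sub>k\<close>. The choice of representatives affects the result only up to an isomorphism that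
  is the identity on objects.
\<close>

definition orbit_cat ::
    "('o, 'k, 'm) lincat \<Rightarrow> ('o, 'm) lfunctor \<Rightarrow> ('o set, 'k, int \<Rightarrow> 'm) lincat" where
  "orbit_cat C F =
     (let r = orbit_rep;
          P = functor_int_power C F;
          H = (\<lambda>X Y k. Hom C (r X) (omap (P k) (r Y)));
          Z = (\<lambda>X Y k. Zero C (r X) (omap (P k) (r Y)))
      in \<lparr> Obj = orbit_of (omap F) ` Obj C,
           Hom = (\<lambda>X Y. {f. (\<forall>k. f k \<in> H X Y k) \<and> finite {k. f k \<noteq> Z X Y k}}),
           Zero = Z,
           Add = (\<lambda>X Y f g k. Add C (r X) (omap (P k) (r Y)) (f k) (g k)),
           Scale = (\<lambda>X Y c f k. Scale C (r X) (omap (P k) (r Y)) c (f k)),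
           Ident = (\<lambda>X k. if k = 0 then Ident C (r X) else Z X X k),
           Comp = (\<lambda>X Y W g f n.
             msum C (r X) (omap (P n) (r W))
               (map (\<lambda>k. Comp C (r X) (omap (P k) (r Y)) (omap (P n) (r W))
                           (mmap (P k) (r Y) (omap (P (n - k)) (r W)) (g (n - k)))
                           (f k))
                  (sorted_list_of_set {k. f k \<noteq> Z X Y k}))) \<rparr>)"


section \<open>The continuous cluster category\<close>

text \<open>
  The categories of this section up to \<open>cluster_ind\<close> are the categories of indecomposable objects;
  formal direct sums of these are added at the end, in \<open>cluster_cat\<close>.
\<close>

type_synonym point = "real \<times> real"

type_synonym cobj = "(point \<times> bool) set"

definition B_ind :: "(point, 'k::field, 'k) lincat" where
  "B_ind =
    \<lparr> Obj = UNIV,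
      Hom = (\<lambda>(x, y) (x', y'). if x \<le> x' \<and> y \<le> y' then UNIV else {0}),
      Zero = (\<lambda>_ _. 0),
      Add = (\<lambda>_ _ f g. f + g),
      Scale = (\<lambda>_ _ c f. c * f),
      Ident = (\<lambda>_. 1),
      Comp = (\<lambda>_ _ _ g f. g * f) \<rparr>"

definition B_pi :: "point set" where
  "B_pi = {(x, y). pi \<le> \<bar>y - x\<bar>}"

definition D_ind :: "(point, 'k::field, 'k set) lincat" where
  "D_ind = full_subcat (quotient_cat B_ind B_pi) {(x, y). \<bar>y - x\<bar> < pi}"

definition D2_ind :: "(point \<times> bool, 'k::field, 'k set) lincat" where
  "D2_ind = doubled_cat D_ind"

definition F_obj :: "point \<times> bool \<Rightarrow> point \<times> bool" where
  "F_obj = (\<lambda>((x, y), i). ((y + pi, x + pi), \<not> i))"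

text \<open>
  The basic morphism is the class of the scalar 1, so \<open>F\<close>, which is linear and preserves basic
  morphisms, sends the class of each scalar to the class of the same scalar.
\<close>

definition F_functor :: "(point \<times> bool, 'k::field set) lfunctor" where
  "F_functor =
    \<lparr> omap = F_obj,
      mmap = (\<lambda>X Y f. \<Union>c\<in>f. ideal_coset B_ind B_pi (fst (F_obj X)) (fst (F_obj Y)) c) \<rparr>"

definition cluster_ind :: "(cobj, 'k::field, int \<Rightarrow> 'k set) lincat" where
  "cluster_ind = orbit_cat D2_ind F_functor"

definition cluster_cat :: "(cobj list, 'k::field, (int \<Rightarrow> 'k set) list list) lincat" where
  "cluster_cat = additive_closure cluster_ind"

definition M :: "real \<Rightarrow> real \<Rightarrow> cobj" where
  "M x y = orbit_of F_obj ((x, y), False)"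

text \<open>
  For \<open>n = 0\<close> and \<open>m = 1\<close> the formula gives the point \<open>(\<pi>, \<pi>)\<close>, an object isomorphic to \<open>M 0 0\<close>.
\<close>

definition standard_cluster :: "cobj set" where
  "standard_cluster =
     {M (real m * pi / 2 ^ n) (pi + (real m - 1) * pi / 2 ^ n) |m n.
        m < 2 ^ (n + 1) \<and> (m, n) \<noteq> (1, 0)}"

definition add_standard_cluster :: "'k::field itself \<Rightarrow> cobj list set" where
  "add_standard_cluster _ =
     add_generated (cluster_ind :: (cobj, 'k, int \<Rightarrow> 'k set) lincat) standard_cluster"

definition rational_objects :: "cobj set" where
  "rational_objects =
     {M (of_int a * pi / 2 ^ n) (of_int b * pi / 2 ^ n) |(a::int) (b::int) (n::nat).
        \<bar>a - b\<bar> < 2 ^ n}"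

definition X_cat :: "(cobj list, 'k::field, (int \<Rightarrow> 'k set) list list) lincat" where
  "X_cat = full_subcat cluster_cat
     (add_generated (cluster_ind :: (cobj, 'k, int \<Rightarrow> 'k set) lincat) rational_objects)"

definition support_ind :: "'k::field itself \<Rightarrow> cobj \<Rightarrow> cobj set" where
  "support_ind _ X =
     (let C = (cluster_ind :: (cobj, 'k, int \<Rightarrow> 'k set) lincat)
      in {S \<in> standard_cluster. \<not> isomorphic C S X \<and> hom_nonzero C S X \<and> hom_nonzero C X S})"

definition support :: "'k::field itself \<Rightarrow> cobj list \<Rightarrow> cobj set" where
  "support K Xs = (\<Union>X\<in>set Xs. support_ind K X)"

end

theory Submission imports Defs begin

text \<open>
  Attach to a point \<open>(x, y)\<close> of the strip \<open>\<bar>y - x\<bar> < \<pi>\<close> the arc with the ends \<open>x\<close> and \<open>y + \<pi>\<close> on the circle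
  \<open>\<real>/2\<pi>\<int>\<close>. The map \<open>(x, y) \<mapsto> (y + \<pi>, x + \<pi>)\<close> underlying \<open>F\<close> exchanges the two ends, so indecomposable
  objects of the cluster category, up to isomorphism, are arcs with two distinct ends. Morphisms in both
  directions between non-isomorphic indecomposables exist iff their arcs cross, that is, iff their ends are distinct
  and alternate on the circle (\<open>crosses_iff\<close>). In this language the standard cluster consists, up to isomorphism, of the arcs
  \<open>[(m - 1)\<pi>/2\<^sup>n, m\<pi>/2\<^sup>n]\<close>, and the objects of \<open>\<X>\<close> are the arcs whose ends are both dyadic multiples of \<open>\<pi>\<close>.

  An arc crosses an interval \<open>[(m - 1)\<pi>/2\<^sup>n, m\<pi>/2\<^sup>n]\<close> iff one end lies in its interior and the other one in the interior
  of its complement. If both ends are multiples of \<open>\<pi>/2\<^sup>N\<close>, neither is an interior point of an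
  interval of level \<open>n \<ge> N\<close>, so only finitely many intervals are crossed. If an end is not dyadic, then at every
  level it is interior to some interval, and for large \<open>n\<close> this interval is too short to contain the other end as
  well; so infinitely many intervals are crossed (\<open>support_ind_finite_iff\<close>).

  The intervals do not cross one another (\<open>arc_not_crosses_level\<close>). Conversely, suppose that an arc crosses none.
  Then its ends are dyadic. Take the smallest \<open>n\<close> such that both are multiples of \<open>\<pi>/2\<^sup>n\<close>. If \<open>n > 0\<close>, one
  end is an odd multiple, hence the midpoint of an interval of level \<open>n - 1\<close>. As this interval is not
  crossed, the other end is one of its two end points, so the arc joins neighbouring multiples of
  \<open>\<pi>/2\<^sup>n\<close> (\<open>dyadic_uncrossed_is_arc\<close>).

  Both statements pass from indecomposables to direct sums because an isomorphism of formal direct sums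
  matches up the isomorphism classes of the summands (\<open>add_generated_cluster_ind\<close>).
\<close>

section \<open>Isomorphisms between formal direct sums\<close>

lemma length_mat [simp]: "length (mat r c e) = r"
  by (simp add: mat_def)

lemma mat_nth [simp]: "j < r \<Longrightarrow> i < c \<Longrightarrow> mat r c e ! j ! i = e j i"
  by (simp add: mat_def)

lemma length_mat_nth [simp]: "j < r \<Longrightarrow> length (mat r c e ! j) = c"
  by (simp add: mat_def)

lemma mat_cong:
  assumes "\<And>j i. j < r \<Longrightarrow> i < c \<Longrightarrow> e j i = e' j i"
  shows "mat r c e = mat r c e'"
  unfolding mat_def using assms by (auto intro!: map_cong)

text \<open>
  The part of the axioms of a linear category that a diagonal matrix and its inverse
  involve: outside the diagonal only zero morphisms are composed and added.
\<close>

locale category_with_zeros =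
  fixes C :: "('o, 'k, 'm) lincat"
  assumes zero_in_Hom: "X \<in> Obj C \<Longrightarrow> Y \<in> Obj C \<Longrightarrow> Zero C X Y \<in> Hom C X Y"
    and ident_in_Hom: "X \<in> Obj C \<Longrightarrow> Ident C X \<in> Hom C X X"
    and add_zero_right: "X \<in> Obj C \<Longrightarrow> Y \<in> Obj C \<Longrightarrow> f \<in> Hom C X Y \<Longrightarrow>
          Add C X Y f (Zero C X Y) = f"
    and add_zero_left: "X \<in> Obj C \<Longrightarrow> Y \<in> Obj C \<Longrightarrow> f \<in> Hom C X Y \<Longrightarrow>
          Add C X Y (Zero C X Y) f = f"
    and comp_zero_left: "X \<in> Obj C \<Longrightarrow> Y \<in> Obj C \<Longrightarrow> Z \<in> Obj C \<Longrightarrow> f \<in> Hom C X Y \<Longrightarrow>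
          Comp C X Y Z (Zero C Y Z) f = Zero C X Z"
    and comp_zero_right: "X \<in> Obj C \<Longrightarrow> Y \<in> Obj C \<Longrightarrow> Z \<in> Obj C \<Longrightarrow> g \<in> Hom C Y Z \<Longrightarrow>
          Comp C X Y Z g (Zero C X Y) = Zero C X Z"
begin

lemma msum_zeros:
  assumes "X \<in> Obj C" "Y \<in> Obj C" "set fs \<subseteq> {Zero C X Y}"
  shows "msum C X Y fs = Zero C X Y"
  using assms(3)
  by (induction fs) (simp_all add: msum_def add_zero_right zero_in_Hom assms(1,2))

lemma msum_single:
  assumes X: "X \<in> Obj C" and Y: "Y \<in> Obj C"
    and "distinct ks" "i \<in> set ks" "h i \<in> Hom C X Y"
    and "\<And>k. k \<in> set ks \<Longrightarrow> k \<noteq> i \<Longrightarrow> h k = Zero C X Y"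
  shows "msum C X Y (map h ks) = h i"
  using assms(3-)
proof (induction ks)
  case (Cons k ks)
  show ?case
  proof (cases "k = i")
    case True
    with Cons.prems have "msum C X Y (map h ks) = Zero C X Y"
      by (intro msum_zeros X Y) auto
    then show ?thesis
      using True Cons.prems X Y by (simp add: msum_def add_zero_right)
  next
    case False
    with Cons have "msum C X Y (map h ks) = h i"
      by auto
    then show ?thesis
      using False Cons.prems X Y by (simp add: msum_def add_zero_left)
  qed
qed simp

definition diagonal :: "'o list \<Rightarrow> 'o list \<Rightarrow> (nat \<Rightarrow> 'm) \<Rightarrow> 'm list list" where
  "diagonal Xs Ys f =
     mat (length Ys) (length Xs) (\<lambda>j i. if i = j then f i else Zero C (Xs ! i) (Ys ! j))"

lemma diagonal_in_Hom:
  assumes "set Xs \<subseteq> Obj C" "set Ys \<subseteq> Obj C" "length Ys = length Xs"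
    and "\<And>i. i < length Xs \<Longrightarrow> f i \<in> Hom C (Xs ! i) (Ys ! i)"
  shows "diagonal Xs Ys f \<in> Hom (additive_closure C) Xs Ys"
  using assms by (auto simp: additive_closure_def diagonal_def subset_iff intro!: zero_in_Hom)

lemma diagonal_comp:
  assumes Xs: "set Xs \<subseteq> Obj C" and Ys: "set Ys \<subseteq> Obj C" and len: "length Ys = length Xs"
    and f: "\<And>i. i < length Xs \<Longrightarrow> f i \<in> Hom C (Xs ! i) (Ys ! i)"
    and g: "\<And>i. i < length Xs \<Longrightarrow> g i \<in> Hom C (Ys ! i) (Xs ! i)"
    and gf: "\<And>i. i < length Xs \<Longrightarrow>
               Comp C (Xs ! i) (Ys ! i) (Xs ! i) (g i) (f i) = Ident C (Xs ! i)"
  shows "Comp (additive_closure C) Xs Ys Xs (diagonal Ys Xs g) (diagonal Xs Ys f)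
           = Ident (additive_closure C) Xs"
proof -
  define n where "n = length Xs"
  have X: "Xs ! i \<in> Obj C" and Y: "Ys ! i \<in> Obj C" if "i < n" for i
    using that Xs Ys len by (auto simp: n_def subset_iff)
  define h where "h j i k = Comp C (Xs ! i) (Ys ! k) (Xs ! j)
      (diagonal Ys Xs g ! j ! k) (diagonal Xs Ys f ! k ! i)" for j i k
  have entry: "msum C (Xs ! i) (Xs ! j) (map (h j i) [0..<n])
      = (if i = j then Ident C (Xs ! i) else Zero C (Xs ! i) (Xs ! j))"
    if j: "j < n" and i: "i < n" for i j
  proof -
    have off: "h j i k = Zero C (Xs ! i) (Xs ! j)" if "k < n" "k \<noteq> i \<or> k \<noteq> j" for k
    proof (cases "k = i")
      case True
      then show ?thesis
        using that i j f X Y len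
        by (auto simp: h_def diagonal_def n_def intro!: comp_zero_left)
    next
      case False
      then show ?thesis
        using that i j g X Y len
        by (auto simp: h_def diagonal_def n_def intro!: comp_zero_right zero_in_Hom)
    qed
    show ?thesis
    proof (cases "i = j")
      case True
      have "h j i i = Ident C (Xs ! i)"
        using True i gf len by (simp add: h_def diagonal_def n_def)
      moreover have "msum C (Xs ! i) (Xs ! j) (map (h j i) [0..<n]) = h j i i"
        using calculation True i X off by (intro msum_single) (auto simp: ident_in_Hom)
      ultimately show ?thesis
        using True by simp
    next
      case False
      then have "msum C (Xs ! i) (Xs ! j) (map (h j i) [0..<n]) = Zero C (Xs ! i) (Xs ! j)"
        using i j X off by (intro msum_zeros) auto
      with False show ?thesis by simp
    qed
  qed
  show ?thesis
    unfolding additive_closure_def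
    by (simp add: len flip: n_def h_def) (intro mat_cong entry; assumption)
qed

lemma isomorphic_direct_sums:
  assumes "list_all2 (isomorphic C) Xs Ys"
  shows "isomorphic (additive_closure C) Xs Ys"
proof -
  have len: "length Ys = length Xs"
    using assms by (simp add: list_all2_lengthD)
  have iso: "isomorphic C (Xs ! i) (Ys ! i)" if "i < length Xs" for i
    using assms that by (simp add: list_all2_nthD)
  have Xs: "set Xs \<subseteq> Obj C" and Ys: "set Ys \<subseteq> Obj C"
    using iso len by (auto simp: in_set_conv_nth isomorphic_def)
  obtain f g where fg: "\<And>i. i < length Xs \<Longrightarrow> f i \<in> Hom C (Xs ! i) (Ys ! i)"
    "\<And>i. i < length Xs \<Longrightarrow> g i \<in> Hom C (Ys ! i) (Xs ! i)"
    "\<And>i. i < length Xs \<Longrightarrow> Comp C (Xs ! i) (Ys ! i) (Xs ! i) (g i) (f i) = Ident C (Xs ! i)"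
    "\<And>i. i < length Xs \<Longrightarrow> Comp C (Ys ! i) (Xs ! i) (Ys ! i) (f i) (g i) = Ident C (Ys ! i)"
    using iso unfolding isomorphic_def by metis
  have "Obj (additive_closure C) = {Xs. set Xs \<subseteq> Obj C}"
    by (simp add: additive_closure_def)
  moreover have "diagonal Xs Ys f \<in> Hom (additive_closure C) Xs Ys"
    using Xs Ys len fg by (intro diagonal_in_Hom) auto
  moreover have "diagonal Ys Xs g \<in> Hom (additive_closure C) Ys Xs"
    using Xs Ys len fg by (intro diagonal_in_Hom) auto
  moreover have "Comp (additive_closure C) Xs Ys Xs (diagonal Ys Xs g) (diagonal Xs Ys f)
           = Ident (additive_closure C) Xs"
    using Xs Ys len fg by (intro diagonal_comp) auto
  moreover have "Comp (additive_closure C) Ys Xs Ys (diagonal Xs Ys f) (diagonal Ys Xs g)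
           = Ident (additive_closure C) Ys"
    using Xs Ys len fg by (intro diagonal_comp) auto
  ultimately show ?thesis
    unfolding isomorphic_def using Xs Ys by blast
qed

end

text \<open>
  The uniqueness half of the Krull--Schmidt theorem, in the form needed here. The diagonal entry at
  \<open>X\<close> of \<open>B A = 1\<close> writes the identity of \<open>X\<close> as a sum of composites \<open>X \<rightarrow> Y \<rightarrow> X\<close>. If all of these
  lay in a set \<open>I\<close> of endomorphisms closed under addition, such as the maximal ideal of a local
  endomorphism ring, so would the identity.
\<close>

lemma identity_from_direct_sum_isomorphism:
  assumes iso: "isomorphic (additive_closure C) Xs Ys" and X: "X \<in> set Xs"
    and zero: "Zero C X X \<in> I"
    and add: "\<And>f g. f \<in> I \<Longrightarrow> g \<in> I \<Longrightarrow> Add C X X f g \<in> I"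
    and comp: "\<And>Y f g. Y \<in> set Ys \<Longrightarrow> f \<in> Hom C X Y \<Longrightarrow> g \<in> Hom C Y X \<Longrightarrow>
                 Comp C X Y X g f \<in> I"
  shows "Ident C X \<in> I"
proof -
  obtain i where i: "i < length Xs" "X = Xs ! i"
    using X by (metis in_set_conv_nth)
  obtain A B where A: "A \<in> Hom (additive_closure C) Xs Ys" and B: "B \<in> Hom (additive_closure C) Ys Xs"
    and BA: "Comp (additive_closure C) Xs Ys Xs B A = Ident (additive_closure C) Xs"
    using iso by (auto simp: isomorphic_def)
  let ?h = "\<lambda>k. Comp C X (Ys ! k) X (B ! i ! k) (A ! k ! i)"
  have "Ident C X = Ident (additive_closure C) Xs ! i ! i"
    using i by (simp add: additive_closure_def)
  also have "\<dots> = msum C X X (map ?h [0..<length Ys])"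
    using i unfolding BA [symmetric] by (simp add: additive_closure_def)
  also have "\<dots> \<in> I"
  proof -
    have "foldr (Add C X X) fs (Zero C X X) \<in> I" if "set fs \<subseteq> I" for fs
      using that by (induction fs) (use zero add in auto)
    moreover have "set (map ?h [0..<length Ys]) \<subseteq> I"
      using A B i by (auto simp: additive_closure_def intro!: comp [unfolded i(2)])
    ultimately show ?thesis
      unfolding msum_def by blast
  qed
  finally show ?thesis .
qed


section \<open>The category of indecomposables of the continuous derived category\<close>

definition below :: "point \<Rightarrow> point \<Rightarrow> bool" where
  "below p q \<longleftrightarrow> fst p \<le> fst q \<and> snd p \<le> snd q"

text \<open>
  A path upwards from \<open>p\<close> to \<open>q\<close> can leave the strip iff one of the two other corners of the rectangle
  spanned by \<open>p\<close> and \<open>q\<close> lies outside it, as \<open>y - x\<close> and \<open>x - y\<close> attain their maxima on the rectangle there.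
\<close>

definition killed :: "point \<Rightarrow> point \<Rightarrow> bool" where
  "killed p q \<longleftrightarrow> below p q \<and> (pi \<le> snd q - fst p \<or> pi \<le> fst q - snd p)"

definition reaches :: "point \<Rightarrow> point \<Rightarrow> bool" where
  "reaches p q \<longleftrightarrow> below p q \<and> \<not> killed p q"

definition strip :: "point set" where
  "strip = {(x, y). \<bar>y - x\<bar> < pi}"

lemma below_refl [simp]: "below p p"
  by (simp add: below_def)

lemma below_antisym: "below p q \<Longrightarrow> below q p \<Longrightarrow> p = q"
  by (auto simp: below_def prod_eq_iff)

lemma killed_below: "killed p q \<Longrightarrow> below p q"
  by (simp add: killed_def)

lemma killed_mono: "below p p' \<Longrightarrow> below q' q \<Longrightarrow> killed p' q' \<Longrightarrow> killed p q"
  by (auto simp: killed_def below_def)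

lemma killed_refl [simp]: "p \<in> strip \<Longrightarrow> \<not> killed p p"
  by (auto simp: killed_def strip_def)

lemma reaches_refl [simp]: "p \<in> strip \<Longrightarrow> reaches p p"
  by (simp add: reaches_def)

lemma Hom_B_ind: "Hom B_ind p q = (if below p q then UNIV else {0})"
  by (cases p; cases q) (simp add: B_ind_def below_def)

lemma killed_iff_through_B_pi: "killed p q \<longleftrightarrow> (\<exists>z\<in>B_pi. below p z \<and> below z q)"
proof
  assume "killed p q"
  then have "(fst p, snd q) \<in> B_pi \<or> (fst q, snd p) \<in> B_pi"
    "below p (fst p, snd q)" "below (fst p, snd q) q"
    "below p (fst q, snd p)" "below (fst q, snd p) q"
    by (auto simp: killed_def below_def B_pi_def)
  then show "\<exists>z\<in>B_pi. below p z \<and> below z q"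
    by blast
next
  assume "\<exists>z\<in>B_pi. below p z \<and> below z q"
  then obtain a b where ab: "pi \<le> \<bar>b - a\<bar>" "fst p \<le> a" "a \<le> fst q" "snd p \<le> b" "b \<le> snd q"
    by (auto simp: B_pi_def below_def)
  from ab(1) have "pi \<le> b - a \<or> pi \<le> a - b"
    by linarith
  with ab show "killed p q"
    by (auto simp: killed_def below_def)
qed

lemma factor_ideal_B_ind:
  "factor_ideal (B_ind :: (point, 'k::field, 'k) lincat) B_pi p q = (if killed p q then UNIV else {0})"
proof (cases "killed p q")
  case True
  then obtain z where z: "z \<in> B_pi" "below p z" "below z q"
    by (auto simp: killed_iff_through_B_pi)
  have "c \<in> factor_ideal (B_ind :: (point, 'k, 'k) lincat) B_pi p q" for c
    unfolding factor_ideal_def mem_Collect_eq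
    using z by (intro exI [of _ "[(z, c, 1)]"]) (simp add: Hom_B_ind msum_def, simp add: B_ind_def)
  with True show ?thesis
    by auto
next
  case False
  have "msum (B_ind :: (point, 'k, 'k) lincat) p q (map (\<lambda>(z, g, h). Comp B_ind p z q g h) ps) = 0"
    if "\<forall>(z, g, h)\<in>set ps. z \<in> B_pi \<and> h \<in> Hom B_ind p z \<and> g \<in> Hom B_ind z q" for ps
    using that
  proof (induction ps)
    case (Cons a ps)
    obtain z g h where a: "a = (z, g, h)"
      by (cases a)
    with Cons.prems False have "g * h = 0"
      by (auto simp: Hom_B_ind killed_iff_through_B_pi split: if_splits)
    with Cons a show ?case
      by (simp add: msum_def) (simp add: B_ind_def)
  qed (simp add: msum_def B_ind_def)
  moreover have "0 \<in> factor_ideal (B_ind :: (point, 'k, 'k) lincat) B_pi p q"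
    unfolding factor_ideal_def mem_Collect_eq
    by (intro exI [of _ "[]"]) (simp add: msum_def B_ind_def)
  ultimately have "factor_ideal (B_ind :: (point, 'k, 'k) lincat) B_pi p q = {0}"
    unfolding factor_ideal_def by blast
  with False show ?thesis
    by simp
qed

abbreviation coset :: "point \<Rightarrow> point \<Rightarrow> 'k::field \<Rightarrow> 'k set" where
  "coset \<equiv> ideal_coset B_ind B_pi"

lemma coset_eq: "coset p q c = (if killed p q then UNIV else {c})"
proof -
  have "(+) c ` UNIV = UNIV"
    by (rule surjI [of _ "\<lambda>x. x - c"]) simp
  then show ?thesis
    by (simp add: ideal_coset_def factor_ideal_B_ind) (simp add: B_ind_def)
qed

lemma D_ind_simps:
  "Obj D_ind = strip"
  "Hom D_ind p q = coset p q ` Hom B_ind p q"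
  "Zero D_ind p q = coset p q 0"
  "Add D_ind p q A B = (\<Union>a\<in>A. \<Union>b\<in>B. coset p q (a + b))"
  "Ident D_ind p = coset p p 1"
  "Comp D_ind p q r B A = (\<Union>b\<in>B. \<Union>a\<in>A. coset p r (b * a))"
  by (auto simp: D_ind_def full_subcat_def quotient_cat_def strip_def B_ind_def)

lemma Hom_D_ind_not_reaches: "\<not> reaches p q \<Longrightarrow> Hom D_ind p q = {Zero D_ind p q}"
  by (auto simp: D_ind_simps Hom_B_ind reaches_def coset_eq)

lemma Hom_D_ind_reaches: "reaches p q \<Longrightarrow> Hom D_ind p q = range (\<lambda>c. {c})"
  by (auto simp: D_ind_simps Hom_B_ind reaches_def coset_eq)

lemma Zero_D_ind_reaches: "reaches p q \<Longrightarrow> Zero D_ind p q = {0}"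
  by (auto simp: D_ind_simps reaches_def coset_eq)

interpretation D: category_with_zeros "D_ind :: (point, 'k::field, 'k set) lincat"
proof
  fix p q r :: point and f :: "'k set"
  show "Zero D_ind p q \<in> Hom D_ind p q"
    by (auto simp: D_ind_simps Hom_B_ind)
  show "Ident D_ind p \<in> (Hom D_ind p p :: 'k set set)"
    by (auto simp: D_ind_simps Hom_B_ind)
  assume f: "f \<in> Hom D_ind p q"
  show "Add D_ind p q f (Zero D_ind p q) = f" "Add D_ind p q (Zero D_ind p q) f = f"
    using f by (auto simp: D_ind_simps coset_eq)
  show "Comp D_ind p q r (Zero D_ind q r) f = Zero D_ind p r"
    using f killed_mono [of p q r r] killed_below [of q r] killed_below [of p q]
    by (auto simp: D_ind_simps coset_eq Hom_B_ind split: if_splits)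
next
  fix p q r :: point and g :: "'k set"
  assume g: "g \<in> Hom D_ind q r"
  show "Comp D_ind p q r g (Zero D_ind p q) = Zero D_ind p r"
    using g killed_mono [of p p q r] killed_below [of p q] killed_below [of q r]
    by (auto simp: D_ind_simps coset_eq Hom_B_ind split: if_splits)
qed

lemma Comp_D_ind_reaches:
  assumes "reaches p r"
  shows "Comp D_ind p q r {b} {a} = {b * a}"
  using assms by (simp add: D_ind_simps coset_eq reaches_def)

text \<open>Nonzero morphisms go upwards in the product order, which is antisymmetric.\<close>

lemma Comp_D_ind_endo_zero:
  assumes p: "p \<in> strip" and q: "q \<in> strip" and "p \<noteq> q" and "f \<in> Hom D_ind p q" "g \<in> Hom D_ind q p"
  shows "Comp D_ind p q p g f = Zero D_ind p p"
proof (cases "below p q")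
  case True
  then have "\<not> reaches q p"
    using below_antisym \<open>p \<noteq> q\<close> unfolding reaches_def by blast
  with assms(5) have "g = Zero D_ind q p"
    by (simp add: Hom_D_ind_not_reaches)
  with assms show ?thesis
    by (simp add: D.comp_zero_left D_ind_simps(1))
next
  case False
  with assms(4) have "f = Zero D_ind p q"
    by (simp add: Hom_D_ind_not_reaches reaches_def)
  with assms show ?thesis
    by (simp add: D.comp_zero_right D_ind_simps(1))
qed


section \<open>Powers of the shift functor\<close>

text \<open>The \<open>k\<close>-th power of \<open>(x, y) \<mapsto> (y + \<pi>, x + \<pi>)\<close>, whose square is the translation by \<open>2\<pi>\<close>.\<close>

definition shift :: "int \<Rightarrow> point \<Rightarrow> point" where
  "shift k p = (if even k then (fst p + of_int k * pi, snd p + of_int k * pi)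
                else (snd p + of_int k * pi, fst p + of_int k * pi))"

definition flagged_shift :: "int \<Rightarrow> point \<times> bool \<Rightarrow> point \<times> bool" where
  "flagged_shift k X = (shift k (fst X), snd X = even k)"

lemma shift_0 [simp]: "shift 0 p = p"
  by (simp add: shift_def)

lemma shift_shift [simp]: "shift j (shift k p) = shift (j + k) p"
  by (auto simp: shift_def algebra_simps)

lemma fst_flagged_shift [simp]: "fst (flagged_shift k X) = shift k (fst X)"
  by (simp add: flagged_shift_def)

lemma flagged_shift_0 [simp]: "flagged_shift 0 X = X"
  by (simp add: flagged_shift_def)

lemma flagged_shift_flagged_shift [simp]:
  "flagged_shift j (flagged_shift k X) = flagged_shift (j + k) X"
  by (auto simp: flagged_shift_def)

lemma shift_in_strip [simp]: "shift k p \<in> strip \<longleftrightarrow> p \<in> strip"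
  by (auto simp: shift_def strip_def)

lemma below_shift [simp]: "below (shift k p) (shift k q) \<longleftrightarrow> below p q"
  by (auto simp: below_def shift_def)

lemma killed_shift [simp]: "killed (shift k p) (shift k q) \<longleftrightarrow> killed p q"
  unfolding killed_def by (simp add: shift_def below_def) (auto simp: algebra_simps)

lemma reaches_shift [simp]: "reaches (shift k p) (shift k q) \<longleftrightarrow> reaches p q"
  by (simp add: reaches_def)

lemma coset_shift [simp]: "coset (shift k p) (shift k q) = coset p q"
  by (intro ext) (simp add: coset_eq)

lemma D_ind_shift [simp]:
  "Hom D_ind (shift k p) (shift k q) = Hom D_ind p q"
  "Zero D_ind (shift k p) (shift k q) = Zero D_ind p q"
  by (simp_all add: D_ind_simps Hom_B_ind)

lemma D_ind_shift_left:
  "Hom D_ind (shift k p) q = Hom D_ind p (shift (- k) q)"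
  "Zero D_ind (shift k p) q = Zero D_ind p (shift (- k) q)"
  using D_ind_shift [of k p "shift (- k) q"] by simp_all

lemma F_obj_eq: "F_obj = flagged_shift 1"
  by (auto simp: F_obj_def flagged_shift_def shift_def)

lemma D2_ind_simps:
  "Obj D2_ind = {X. fst X \<in> strip}"
  "Hom D2_ind X Y = Hom D_ind (fst X) (fst Y)"
  "Zero D2_ind X Y = Zero D_ind (fst X) (fst Y)"
  "Add D2_ind X Y = Add D_ind (fst X) (fst Y)"
  "Ident D2_ind X = Ident D_ind (fst X)"
  "Comp D2_ind X Y Z = Comp D_ind (fst X) (fst Y) (fst Z)"
  by (auto simp: D2_ind_def doubled_cat_def D_ind_simps(1))

text \<open>
  Morphisms of the quotient category are cosets of scalars, and a shift of both ends does not
  change the ideal. So a functor that preserves classes of scalars acts as the identity on the underlying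
  sets of morphisms.
\<close>

definition acts_as_shift :: "int \<Rightarrow> (point \<times> bool, 'k::field set) lfunctor \<Rightarrow> bool" where
  "acts_as_shift e T \<longleftrightarrow>
     (\<forall>X. fst X \<in> strip \<longrightarrow> omap T X = flagged_shift e X) \<and>
     (\<forall>X Y f. fst X \<in> strip \<longrightarrow> fst Y \<in> strip \<longrightarrow> f \<in> Hom D2_ind X Y \<longrightarrow> mmap T X Y f = f)"

lemma acts_as_shift_omap: "acts_as_shift e T \<Longrightarrow> fst X \<in> strip \<Longrightarrow> omap T X = flagged_shift e X"
  unfolding acts_as_shift_def by blast

lemma acts_as_shift_mmap:
  "acts_as_shift e T \<Longrightarrow> fst X \<in> strip \<Longrightarrow> fst Y \<in> strip \<Longrightarrow> f \<in> Hom D2_ind X Y \<Longrightarrow> mmap T X Y f = f"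
  unfolding acts_as_shift_def by blast

lemma Hom_D2_flagged_shift [simp]:
  "Hom D2_ind (flagged_shift k X) (flagged_shift k Y) = Hom D2_ind X Y"
  by (simp add: D2_ind_simps)

lemma F_functor_acts_as_shift: "acts_as_shift 1 F_functor"
  unfolding acts_as_shift_def
  by (auto simp: F_functor_def F_obj_eq D2_ind_simps D_ind_simps coset_eq)

lemma inverse_F_functor_acts_as_shift:
  "acts_as_shift (- 1) (inverse_functor (D2_ind :: (point \<times> bool, 'k::field, 'k set) lincat) F_functor)"
proof -
  let ?D = "D2_ind :: (point \<times> bool, 'k, 'k set) lincat"
  let ?G = "inv_into ({X. fst X \<in> strip}) F_obj"
  have "inj_on F_obj ({X. fst X \<in> strip})"
    by (rule inj_on_inverseI [of _ "flagged_shift (- 1)"]) (simp add: F_obj_eq)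
  then have G: "?G X = flagged_shift (- 1) X" if "fst X \<in> strip" for X
    using that by (intro inv_into_f_eq) (auto simp: F_obj_eq)
  have "inv_into (Hom ?D (?G X) (?G Y)) (mmap F_functor (?G X) (?G Y)) f = f"
    if X: "fst X \<in> strip" and Y: "fst Y \<in> strip" and f: "f \<in> Hom ?D X Y" for X Y f
  proof (rule inv_into_f_eq)
    have id: "mmap F_functor (?G X) (?G Y) h = h" if "h \<in> Hom ?D (?G X) (?G Y)" for h
      using that X Y by (intro acts_as_shift_mmap [OF F_functor_acts_as_shift]) (simp_all add: G)
    show "inj_on (mmap F_functor (?G X) (?G Y)) (Hom ?D (?G X) (?G Y))"
      by (rule inj_onI) (simp add: id)
    show f': "f \<in> Hom ?D (?G X) (?G Y)"
      using f X Y by (simp add: G)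
    show "mmap F_functor (?G X) (?G Y) f = f"
      by (rule id [OF f'])
  qed
  with G show ?thesis
    by (simp add: acts_as_shift_def inverse_functor_def Let_def D2_ind_simps(1) F_functor_def)
qed

lemma functor_power_acts_as_shift:
  assumes "acts_as_shift e T"
  shows "acts_as_shift (e * int n) (functor_power T n)"
proof (induction n)
  case (Suc n)
  show ?case
    unfolding acts_as_shift_def
    by (simp add: Let_def distrib_left acts_as_shift_omap [OF Suc] acts_as_shift_mmap [OF Suc]
        acts_as_shift_omap [OF assms] acts_as_shift_mmap [OF assms] del: split_paired_All)
qed (simp add: acts_as_shift_def)

lemma functor_int_power_acts_as_shift:
  "acts_as_shift k (functor_int_power (D2_ind :: (point \<times> bool, 'k::field, 'k set) lincat) F_functor k)"
proof (cases "0 \<le> k")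
  case True
  then show ?thesis
    using functor_power_acts_as_shift [OF F_functor_acts_as_shift, of "nat k"]
    by (simp add: functor_int_power_def)
next
  case False
  then show ?thesis
    using functor_power_acts_as_shift [OF inverse_F_functor_acts_as_shift, of "nat (- k)"]
    by (simp add: functor_int_power_def)
qed


section \<open>Indecomposable objects of the cluster category\<close>

definition same_orbit :: "point \<Rightarrow> point \<Rightarrow> bool" where
  "same_orbit p q \<longleftrightarrow> (\<exists>k. q = shift k p)"

lemma same_orbit_refl [simp]: "same_orbit p p"
  unfolding same_orbit_def by (metis shift_0)

lemma same_orbit_shift [simp]: "same_orbit p (shift k p)"
  by (auto simp: same_orbit_def)

lemma same_orbit_sym: "same_orbit p q \<Longrightarrow> same_orbit q p"
  unfolding same_orbit_def by (metis shift_shift shift_0 add.left_inverse)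

lemma same_orbit_trans: "same_orbit p q \<Longrightarrow> same_orbit q r \<Longrightarrow> same_orbit p r"
  unfolding same_orbit_def by (metis shift_shift)

lemma F_obj_funpow: "(F_obj ^^ n) X = flagged_shift (int n) X"
  by (induction n) (simp_all add: F_obj_eq)

lemma orbit_of_F_obj: "orbit_of F_obj X = range (\<lambda>k. flagged_shift k X)"
proof -
  have "(\<exists>n. flagged_shift (int n) X = Y \<or> flagged_shift (int n) Y = X) \<longleftrightarrow> (\<exists>k. Y = flagged_shift k X)"
    for Y
  proof
    assume "\<exists>n. flagged_shift (int n) X = Y \<or> flagged_shift (int n) Y = X"
    then obtain n where "Y = flagged_shift (int n) X \<or> X = flagged_shift (int n) Y"
      by auto
    moreover have "Y = flagged_shift (- int n) (flagged_shift (int n) Y)"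
      by simp
    ultimately show "\<exists>k. Y = flagged_shift k X"
      by metis
  next
    assume "\<exists>k. Y = flagged_shift k X"
    then obtain k where Y: "Y = flagged_shift k X" ..
    show "\<exists>n. flagged_shift (int n) X = Y \<or> flagged_shift (int n) Y = X"
    proof (cases "0 \<le> k")
      case True
      with Y show ?thesis by (intro exI [of _ "nat k"]) simp
    next
      case False
      with Y show ?thesis by (intro exI [of _ "nat (- k)"]) simp
    qed
  qed
  then show ?thesis
    by (auto simp: orbit_of_def F_obj_funpow)
qed

text \<open>
  The point under the representative that enters the morphism sets of the orbit category. Its copy
  can be forgotten, since \<open>(x, y)'\<close> and \<open>(x, y)\<close> are isomorphic; the point itself is determined by the object
  up to \<open>same_orbit\<close>.
\<close>

definition position :: "cobj \<Rightarrow> point" where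
  "position U = fst (orbit_rep U)"

lemma position_orbit: "same_orbit p (position (orbit_of F_obj (p, i)))"
proof -
  have "(p, i) \<in> orbit_of F_obj (p, i)"
    unfolding orbit_of_F_obj by (metis rangeI flagged_shift_0)
  then have "orbit_rep (orbit_of F_obj (p, i)) \<in> orbit_of F_obj (p, i)"
    unfolding orbit_rep_def by (rule someI)
  then show ?thesis
    by (auto simp: orbit_of_F_obj position_def)
qed

lemma position_M: "same_orbit (x, y) (position (M x y))"
  by (simp add: M_def position_orbit)

definition indecomposables :: "cobj set" where
  "indecomposables = orbit_of F_obj ` {X. fst X \<in> strip}"

lemma Obj_cluster_ind: "Obj cluster_ind = indecomposables"
  by (simp add: indecomposables_def cluster_ind_def orbit_cat_def Let_def D2_ind_simps F_functor_def)

lemma position_in_strip: "U \<in> indecomposables \<Longrightarrow> position U \<in> strip"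
proof -
  assume "U \<in> indecomposables"
  then obtain p i where "p \<in> strip" "U = orbit_of F_obj (p, i)"
    by (auto simp: indecomposables_def)
  then show ?thesis
    using position_orbit [of p i] by (auto simp: same_orbit_def)
qed

lemma M_in_indecomposables: "M x y \<in> indecomposables \<longleftrightarrow> (x, y) \<in> strip"
proof
  show "(x, y) \<in> strip" if "M x y \<in> indecomposables"
    using position_in_strip [OF that] position_M [of x y] by (auto simp: same_orbit_def)
qed (auto simp: indecomposables_def M_def)

lemma omap_functor_int_power:
  "V \<in> indecomposables \<Longrightarrow>
     omap (functor_int_power (D2_ind :: (point \<times> bool, 'k::field, 'k set) lincat) F_functor k) (orbit_rep V)
       = flagged_shift k (orbit_rep V)"
  using position_in_strip [of V]
  by (intro acts_as_shift_omap functor_int_power_acts_as_shift) (simp add: position_def)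

lemma cluster_ind_simps:
  assumes "U \<in> indecomposables" "V \<in> indecomposables"
  shows
    "Hom cluster_ind U V = {f. (\<forall>k. f k \<in> Hom D_ind (position U) (shift k (position V))) \<and>
        finite {k. f k \<noteq> Zero D_ind (position U) (shift k (position V))}}"
    "Zero cluster_ind U V k = Zero D_ind (position U) (shift k (position V))"
    "Add cluster_ind U V f g k = Add D_ind (position U) (shift k (position V)) (f k) (g k)"
    "Ident cluster_ind U k =
       (if k = 0 then Ident D_ind (position U) else Zero cluster_ind U U k)"
  using assms
  by (simp_all add: cluster_ind_def orbit_cat_def Let_def omap_functor_int_power D2_ind_simps
      position_def)

lemma msum_D2_ind: "msum D2_ind X Y = msum D_ind (fst X) (fst Y)"
  by (simp add: msum_def fun_eq_iff D2_ind_simps)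

lemma Comp_cluster_ind:
  assumes U: "U \<in> indecomposables" and V: "V \<in> indecomposables" and W: "W \<in> indecomposables"
    and g: "g \<in> Hom (cluster_ind :: (cobj, 'k::field, int \<Rightarrow> 'k set) lincat) V W"
  shows "Comp cluster_ind U V W g f n =
     msum D_ind (position U) (shift n (position W))
       (map (\<lambda>k. Comp D_ind (position U) (shift k (position V)) (shift n (position W)) (g (n - k)) (f k))
         (sorted_list_of_set {k. f k \<noteq> Zero D_ind (position U) (shift k (position V))}))"
proof -
  have "mmap (functor_int_power (D2_ind :: (point \<times> bool, 'k, 'k set) lincat) F_functor k) (orbit_rep V) (flagged_shift (n - k) (orbit_rep W))
      (g (n - k)) = g (n - k)" for k
    using position_in_strip [OF V] position_in_strip [OF W] g V W
    by (intro acts_as_shift_mmap [OF functor_int_power_acts_as_shift])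
      (simp_all add: position_def D2_ind_simps cluster_ind_simps)
  then show ?thesis
    using U V W
    by (simp add: cluster_ind_def orbit_cat_def Let_def omap_functor_int_power D2_ind_simps
        position_def msum_D2_ind)
qed

interpretation cluster: category_with_zeros
  "cluster_ind :: (cobj, 'k::field, int \<Rightarrow> 'k set) lincat"
proof (unfold_locales, unfold Obj_cluster_ind)
  let ?C = "cluster_ind :: (cobj, 'k, int \<Rightarrow> 'k set) lincat"
  have *: "Obj D_ind = strip"
    by (simp add: D_ind_simps)
  fix U V W :: cobj and f :: "int \<Rightarrow> 'k set"
  assume U: "U \<in> indecomposables" and V: "V \<in> indecomposables"
  note strip [simp] = position_in_strip [OF U] position_in_strip [OF V]
  show zero: "Zero ?C U V \<in> Hom ?C U V"
    using U V by (simp add: cluster_ind_simps D.zero_in_Hom *)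
  show "Ident ?C U \<in> Hom ?C U U"
    using U D.ident_in_Hom [of "position U"] by (simp add: cluster_ind_simps D.zero_in_Hom *)
  {
    assume f: "f \<in> Hom ?C U V"
    then have fk: "f k \<in> Hom D_ind (position U) (shift k (position V))" for k
      using U V by (simp add: cluster_ind_simps)
    show "Add ?C U V f (Zero ?C U V) = f" "Add ?C U V (Zero ?C U V) f = f"
      using U V fk by (simp_all add: fun_eq_iff cluster_ind_simps D.add_zero_right D.add_zero_left *)
    assume W: "W \<in> indecomposables"
    note [simp] = position_in_strip [OF W]
    show "Comp ?C U V W (Zero ?C V W) f = Zero ?C U W"
    proof
      fix n
      have "Zero ?C V W (n - k) = Zero D_ind (shift k (position V)) (shift n (position W))" for k
        using V W by (simp add: cluster_ind_simps D_ind_shift_left algebra_simps del: D_ind_shift)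
      then show "Comp ?C U V W (Zero ?C V W) f n = Zero ?C U W n"
        using U V W fk
        by (subst Comp_cluster_ind)
          (simp_all add: cluster_ind_simps D.zero_in_Hom * D.comp_zero_left D.msum_zeros image_subset_iff)
    qed
  }
  {
    assume "W \<in> indecomposables" "f \<in> Hom ?C V W"
    then show "Comp ?C U V W f (Zero ?C U V) = Zero ?C U W"
      using U V by (simp add: fun_eq_iff Comp_cluster_ind cluster_ind_simps) (simp add: msum_def)
  }
qed


text \<open>The basic morphism from \<open>U\<close> to the \<open>k\<close>-th shift of \<open>V\<close>, as a morphism of the orbit category.\<close>

definition basic :: "cobj \<Rightarrow> cobj \<Rightarrow> int \<Rightarrow> int \<Rightarrow> 'k::field set" where
  "basic U V k = (\<lambda>j. if j = k then {1} else Zero cluster_ind U V j)"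

lemma basic_in_Hom:
  assumes "U \<in> indecomposables" "V \<in> indecomposables" "reaches (position U) (shift k (position V))"
  shows "basic U V k \<in> Hom (cluster_ind :: (cobj, 'k::field, int \<Rightarrow> 'k set) lincat) U V"
proof -
  have "finite {j. basic U V k j \<noteq> (Zero D_ind (position U) (shift j (position V)) :: 'k set)}"
    by (rule finite_subset [of _ "{k}"]) (auto simp: basic_def cluster_ind_simps assms)
  moreover have "basic U V k j \<in> (Hom D_ind (position U) (shift j (position V)) :: 'k set set)" for j
    using assms position_in_strip
    by (auto simp: basic_def Hom_D_ind_reaches cluster_ind_simps D_ind_simps(1) intro!: D.zero_in_Hom)
  ultimately show ?thesis
    using assms by (simp add: cluster_ind_simps)
qed

lemma hom_nonzero_cluster_ind:
  assumes U: "U \<in> indecomposables" and V: "V \<in> indecomposables"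
  shows "hom_nonzero (cluster_ind :: (cobj, 'k::field, int \<Rightarrow> 'k set) lincat) U V \<longleftrightarrow>
           (\<exists>k. reaches (position U) (shift k (position V)))"
proof
  let ?C = "cluster_ind :: (cobj, 'k, int \<Rightarrow> 'k set) lincat"
  assume "hom_nonzero ?C U V"
  then obtain f where f: "f \<in> Hom ?C U V" "f \<noteq> Zero ?C U V"
    using cluster.zero_in_Hom [of U V] U V unfolding hom_nonzero_def Obj_cluster_ind by blast
  then obtain k where "f k \<noteq> Zero D_ind (position U) (shift k (position V))"
    using U V by (auto simp: fun_eq_iff cluster_ind_simps)
  moreover have "f k \<in> Hom D_ind (position U) (shift k (position V))"
    using f U V by (simp add: cluster_ind_simps)
  ultimately show "\<exists>k. reaches (position U) (shift k (position V))"
    using Hom_D_ind_not_reaches by blast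
next
  let ?C = "cluster_ind :: (cobj, 'k, int \<Rightarrow> 'k set) lincat"
  assume "\<exists>k. reaches (position U) (shift k (position V))"
  then obtain k where k: "reaches (position U) (shift k (position V))" ..
  have "Zero ?C U V k \<noteq> basic U V k k"
    using k U V by (simp add: cluster_ind_simps Zero_D_ind_reaches basic_def)
  then show "hom_nonzero ?C U V"
    using basic_in_Hom [OF U V k, where ?'k = 'k] unfolding hom_nonzero_def by force
qed

text \<open>
  Both factors are concentrated in one degree, and these degrees add up to 0. There the composite
  is the product \<open>1 \<cdot> 1\<close> of two basic morphisms.
\<close>

lemma basic_comp_basic:
  assumes U: "U \<in> indecomposables" and V: "V \<in> indecomposables"
    and k: "position U = shift k (position V)"
  shows "Comp cluster_ind U V U (basic V U (- k)) (basic U V k) =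
           Ident (cluster_ind :: (cobj, 'k::field, int \<Rightarrow> 'k set) lincat) U"
proof
  fix n
  note [simp] = position_in_strip [OF U] position_in_strip [OF V]
  have V': "position V = shift (- k) (position U)"
    by (simp add: k)
  have support: "{j. basic U V k j \<noteq> (Zero D_ind (position U) (shift j (position V)) :: 'k set)} = {k}"
    using U V by (auto simp: basic_def cluster_ind_simps Zero_D_ind_reaches V')
  have g: "basic V U (- k) \<in> Hom (cluster_ind :: (cobj, 'k, int \<Rightarrow> 'k set) lincat) V U"
    using U V by (intro basic_in_Hom) (simp_all add: V')
  have comp: "Comp cluster_ind U V U (basic V U (- k)) (basic U V k) n =
    msum D_ind (position U) (shift n (position U))
      [Comp D_ind (position U) (position U) (shift n (position U)) (basic V U (- k) (n - k)) {1 :: 'k}]"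
    using U V g by (simp add: Comp_cluster_ind support) (simp add: basic_def flip: k)
  show "Comp cluster_ind U V U (basic V U (- k)) (basic U V k) n =
      Ident (cluster_ind :: (cobj, 'k, int \<Rightarrow> 'k set) lincat) U n"
  proof (cases "n = 0")
    case True
    then show ?thesis
      unfolding comp using U D.add_zero_right [of "position U" "position U" "{1 :: 'k}"]
      by (simp add: basic_def msum_def Comp_D_ind_reaches cluster_ind_simps Hom_D_ind_reaches
          D_ind_simps(1)) (simp add: D_ind_simps coset_eq)
  next
    case False
    have "Zero D_ind (position V) (shift (n - k) (position U)) =
        (Zero D_ind (position U) (shift n (position U)) :: 'k set)"
      by (simp add: k D_ind_shift_left del: D_ind_shift)
    moreover have "{1 :: 'k} \<in> Hom D_ind (position U) (position U)"
      by (simp add: Hom_D_ind_reaches)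
    ultimately show ?thesis
      unfolding comp using False U V
      by (simp add: basic_def cluster_ind_simps D.comp_zero_left D_ind_simps(1) D.msum_zeros)
  qed
qed

text \<open>
  A composite \<open>U \<rightarrow> V \<rightarrow> U\<close> has as its component of degree 0 a sum of composites \<open>p \<rightarrow> q \<rightarrow> p\<close> in the strip
  with \<open>q\<close> in the orbit of \<open>V\<close>. Nonzero morphisms only go upwards, so such a composite is zero unless
  \<open>q = p\<close>.
\<close>

lemma degree_0_endo_zero:
  assumes U: "U \<in> indecomposables" and V: "V \<in> indecomposables"
    and "\<not> same_orbit (position U) (position V)"
    and f: "f \<in> Hom cluster_ind U V"
    and g: "g \<in> Hom (cluster_ind :: (cobj, 'k::field, int \<Rightarrow> 'k set) lincat) V U"
  shows "Comp cluster_ind U V U g f 0 = Zero cluster_ind U U 0"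
proof -
  note [simp] = position_in_strip [OF U] position_in_strip [OF V]
  have "Comp D_ind (position U) (shift k (position V)) (position U) (g (0 - k)) (f k) =
      Zero D_ind (position U) (position U)" for k
  proof (rule Comp_D_ind_endo_zero)
    show "position U \<noteq> shift k (position V)"
      using assms(3) same_orbit_sym same_orbit_shift by metis
    show "f k \<in> Hom D_ind (position U) (shift k (position V))"
      using f U V by (simp add: cluster_ind_simps)
    show "g (0 - k) \<in> Hom D_ind (shift k (position V)) (position U)"
      using g U V by (simp add: cluster_ind_simps D_ind_shift_left)
  qed simp_all
  then show ?thesis
    using U V g
    by (simp add: Comp_cluster_ind cluster_ind_simps D_ind_simps(1) D.msum_zeros image_subset_iff)
qed

lemma Ident_degree_0_nonzero:
  assumes "U \<in> indecomposables"
  shows "Ident cluster_ind U 0 \<noteq> Zero (cluster_ind :: (cobj, 'k::field, int \<Rightarrow> 'k set) lincat) U U 0"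
  using assms position_in_strip [OF assms] by (simp add: cluster_ind_simps) (simp add: D_ind_simps coset_eq)

lemma isomorphic_cluster_ind:
  assumes U: "U \<in> indecomposables" and V: "V \<in> indecomposables"
  shows "isomorphic (cluster_ind :: (cobj, 'k::field, int \<Rightarrow> 'k set) lincat) U V \<longleftrightarrow>
           same_orbit (position U) (position V)"
proof
  assume "isomorphic (cluster_ind :: (cobj, 'k, int \<Rightarrow> 'k set) lincat) U V"
  then show "same_orbit (position U) (position V)"
    using degree_0_endo_zero [OF U V] Ident_degree_0_nonzero [OF U]
    unfolding isomorphic_def by metis
next
  let ?C = "cluster_ind :: (cobj, 'k, int \<Rightarrow> 'k set) lincat"
  assume "same_orbit (position U) (position V)"
  then obtain k where k: "position U = shift k (position V)"
    using same_orbit_sym unfolding same_orbit_def by blast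
  then have k': "position V = shift (- k) (position U)"
    by simp
  have "basic U V k \<in> Hom ?C U V" "basic V U (- k) \<in> Hom ?C V U"
    using basic_in_Hom [OF U V, of k] basic_in_Hom [OF V U, of "- k"]
      position_in_strip [OF U] position_in_strip [OF V]
    by (simp_all flip: k k')
  moreover have "Comp ?C U V U (basic V U (- k)) (basic U V k) = Ident ?C U"
    by (rule basic_comp_basic [OF U V k])
  moreover have "Comp ?C V U V (basic U V k) (basic V U (- k)) = Ident ?C V"
    using basic_comp_basic [OF V U k'] by simp
  ultimately show "isomorphic ?C U V"
    unfolding isomorphic_def Obj_cluster_ind using U V by blast
qed

text \<open>
  A summand \<open>U\<close> that is isomorphic to no summand on the other side would have an identity with vanishing
  component of degree 0, since the endomorphisms with this property are closed under addition and contain all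
  composites through the other summands.
\<close>

lemma add_generated_cluster_ind:
  assumes P: "P \<subseteq> indecomposables"
  shows "Xs \<in> add_generated (cluster_ind :: (cobj, 'k::field, int \<Rightarrow> 'k set) lincat) P \<longleftrightarrow>
           set Xs \<subseteq> indecomposables \<and>
           (\<forall>U\<in>set Xs. \<exists>V\<in>P. same_orbit (position U) (position V))"
proof
  let ?C = "cluster_ind :: (cobj, 'k, int \<Rightarrow> 'k set) lincat"
  assume "Xs \<in> add_generated ?C P"
  then obtain Ys where Ys: "set Ys \<subseteq> P" and iso: "isomorphic (additive_closure ?C) Xs Ys"
    by (auto simp: add_generated_def)
  then have Xs: "set Xs \<subseteq> indecomposables"
    by (simp add: isomorphic_def additive_closure_def Obj_cluster_ind)
  have "\<exists>V\<in>P. same_orbit (position U) (position V)" if U: "U \<in> set Xs" for U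
  proof (rule ccontr)
    assume contra: "\<not> ?thesis"
    have U': "U \<in> indecomposables"
      using U Xs by blast
    let ?I = "{h. h 0 = Zero ?C U U 0}"
    have "Ident ?C U \<in> ?I"
    proof (rule identity_from_direct_sum_isomorphism [OF iso U])
      show "Add ?C U U f g \<in> ?I" if "f \<in> ?I" "g \<in> ?I" for f g
        using that U' position_in_strip [OF U']
        by (simp add: cluster_ind_simps D.add_zero_right D.zero_in_Hom D_ind_simps(1))
      show "Comp ?C U V U g f \<in> ?I"
        if "V \<in> set Ys" "f \<in> Hom ?C U V" "g \<in> Hom ?C V U" for V f g
        using that U' Ys P contra degree_0_endo_zero [OF U', of V f g] by blast
    qed simp
    with Ident_degree_0_nonzero [OF U', where ?'k = 'k] show False
      by simp
  qed
  with Xs show "set Xs \<subseteq> indecomposables \<and> (\<forall>U\<in>set Xs. \<exists>V\<in>P. same_orbit (position U) (position V))"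
    by blast
next
  let ?C = "cluster_ind :: (cobj, 'k, int \<Rightarrow> 'k set) lincat"
  assume Xs: "set Xs \<subseteq> indecomposables \<and> (\<forall>U\<in>set Xs. \<exists>V\<in>P. same_orbit (position U) (position V))"
  then obtain \<phi> where \<phi>: "\<And>U. U \<in> set Xs \<Longrightarrow> \<phi> U \<in> P \<and> same_orbit (position U) (position (\<phi> U))"
    by metis
  have "list_all2 (isomorphic ?C) Xs (map \<phi> Xs)"
    using \<phi> Xs P by (auto simp: list_all2_conv_all_nth isomorphic_cluster_ind subset_iff)
  then have "isomorphic (additive_closure ?C) Xs (map \<phi> Xs)"
    by (rule cluster.isomorphic_direct_sums)
  with \<phi> show "Xs \<in> add_generated ?C P"
    unfolding add_generated_def by (auto intro!: exI [of _ "map \<phi> Xs"])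
qed


section \<open>Crossing arcs\<close>

text \<open>
  For the arcs \<open>{a, b}\<close> and \<open>{c, d}\<close> of \<open>p\<close> and \<open>q\<close>, with \<open>a = fst p\<close>, \<open>b = snd p + pi\<close>, \<open>c = fst q\<close> and \<open>d = snd q + pi\<close>,
  this says \<open>a < c < b < d < a + 2\<pi>\<close>: the ends alternate. The condition \<open>reaches p q\<close> is the
  variant that allows \<open>c = a\<close> and \<open>d = b\<close>.
\<close>

definition inside :: "point \<Rightarrow> point \<Rightarrow> bool" where
  "inside p q \<longleftrightarrow> fst p < fst q \<and> fst q < snd p + pi \<and> snd p < snd q \<and> snd q < fst p + pi"

definition crosses :: "point \<Rightarrow> point \<Rightarrow> bool" where
  "crosses p q \<longleftrightarrow> (\<exists>k. inside p (shift k q))"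

lemma reaches_iff:
  "reaches p q \<longleftrightarrow> fst p \<le> fst q \<and> fst q < snd p + pi \<and> snd p \<le> snd q \<and> snd q < fst p + pi"
  by (auto simp: reaches_def killed_def below_def)

lemma inside_shift [simp]: "inside (shift k p) (shift k q) \<longleftrightarrow> inside p q"
  by (auto simp: inside_def shift_def)

lemma crosses_shift_right [simp]: "crosses p (shift k q) \<longleftrightarrow> crosses p q"
proof -
  have "inside p (shift (j - k + k) q)" if "inside p (shift j q)" for j
    using that by simp
  then show ?thesis
    unfolding crosses_def shift_shift by metis
qed

lemma crosses_shift_left [simp]: "crosses (shift k p) q \<longleftrightarrow> crosses p q"
proof -
  have "inside (shift k p) (shift j q) \<longleftrightarrow> inside p (shift (j - k) q)" for j
    using inside_shift [of k p "shift (j - k) q"] by simp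
  then show ?thesis
    unfolding crosses_def by (metis add_diff_cancel_right')
qed

lemma crosses_same_orbit:
  "same_orbit p p' \<Longrightarrow> same_orbit q q' \<Longrightarrow> crosses p q \<longleftrightarrow> crosses p' q'"
  by (auto simp: same_orbit_def)

lemma of_int_mult_pi_mono: "j \<le> k \<Longrightarrow> of_int j * pi \<le> of_int k * pi"
  by (intro mult_right_mono) auto

text \<open>
  An even shift by \<open>j\<close> to the inside would need \<open>j > 0\<close> and so would translate by at least \<open>2\<pi>\<close>, which is too
  far. For odd \<open>j\<close> the requirement \<open>x < y + j\<pi> < y + \<pi>\<close> forces \<open>j \<le> -1\<close> and then \<open>y - x > \<pi>\<close>.
\<close>

lemma not_crosses_self:
  assumes p: "p \<in> strip"
  shows "\<not> crosses p (shift k p)"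
proof
  assume "crosses p (shift k p)"
  then obtain j where j: "inside p (shift j p)"
    by (auto simp: crosses_def)
  have strip: "\<bar>snd p - fst p\<bar> < pi"
    using p by (auto simp: strip_def)
  consider "even j" "j \<le> 0" | "even j" "2 \<le> j" | "odd j" "j \<le> - 1" | "odd j" "1 \<le> j"
    by (cases "even j"; cases "j \<le> 0") (fastforce elim: evenE oddE)+
  then show False
  proof cases
    case 1
    with j strip of_int_mult_pi_mono [OF 1(2)] show False
      by (auto simp: inside_def shift_def)
  next
    case 2
    then have "fst p + of_int j * pi < snd p + pi"
      using j by (simp add: inside_def shift_def)
    moreover have "2 * pi \<le> of_int j * pi"
      using of_int_mult_pi_mono [OF 2(2)] by simp
    ultimately show False
      using strip by linarith
  next
    case 3
    with j strip of_int_mult_pi_mono [OF 3(2)] show False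
      by (auto simp: inside_def shift_def)
  next
    case 4
    with j strip of_int_mult_pi_mono [OF 4(2)] show False
      by (auto simp: inside_def shift_def)
  qed
qed

text \<open>
  The only shifts of \<open>p = (x, y)\<close> that such a \<open>q\<close> can reach are \<open>p\<close> itself and the next one,
  \<open>(y + \<pi>, x + \<pi>)\<close>. The former is impossible for \<open>q \<noteq> p\<close>. For the latter, with \<open>a\<close>, \<open>b\<close>, \<open>c\<close>, \<open>d\<close> as in
  the definition of \<open>inside\<close>, the two chains of inequalities read \<open>a \<le> c < b \<le> d < a + 2\<pi>\<close> and \<open>c \<le> b < d \<le> a + 2\<pi> < c + 2\<pi>\<close>, and together they are
  strict: two arcs with a common end have morphisms in one direction only.
\<close>

lemma reaches_reaches_inside:
  assumes p: "p \<in> strip" and q: "q \<in> strip"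
    and pq: "reaches p q" and qp: "reaches q (shift k p)" and ne: "p \<noteq> q"
  shows "inside p q"
proof -
  have strip: "\<bar>snd p - fst p\<bar> < pi" "\<bar>snd q - fst q\<bar> < pi"
    using p q by (auto simp: strip_def)
  consider "k = 0" | "even k" "k \<le> - 1" | "even k" "2 \<le> k"
    | "k = 1" | "odd k" "k \<le> - 1" | "odd k" "3 \<le> k"
    by (cases "even k"; cases "k \<le> 0"; cases "k = 0 \<or> k = 1") (fastforce elim: evenE oddE)+
  then show ?thesis
  proof cases
    case 1
    with pq qp ne show ?thesis
      by (auto simp: reaches_iff prod_eq_iff)
  next
    case 2
    with pq qp strip of_int_mult_pi_mono [OF 2(2)] show ?thesis
      by (auto simp: reaches_iff shift_def)
  next
    case 3
    with pq qp strip of_int_mult_pi_mono [OF 3(2)] show ?thesis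
      by (auto simp: reaches_iff shift_def)
  next
    case 4
    with pq qp strip ne show ?thesis
      by (auto simp: reaches_iff inside_def shift_def prod_eq_iff)
  next
    case 5
    with pq qp strip of_int_mult_pi_mono [OF 5(2)] show ?thesis
      by (auto simp: reaches_iff shift_def)
  next
    case 6
    with pq qp strip of_int_mult_pi_mono [OF 6(2)] show ?thesis
      by (auto simp: reaches_iff shift_def)
  qed
qed

lemma crosses_iff:
  assumes p: "p \<in> strip" and q: "q \<in> strip"
  shows "crosses p q \<longleftrightarrow>
    \<not> same_orbit p q \<and> (\<exists>k. reaches p (shift k q)) \<and> (\<exists>k. reaches q (shift k p))"
proof
  assume cr: "crosses p q"
  then obtain k where k: "inside p (shift k q)"
    by (auto simp: crosses_def)
  have "\<bar>snd p - fst p\<bar> < pi" "\<bar>snd (shift k q) - fst (shift k q)\<bar> < pi"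
    using p shift_in_strip [of k q] q by (auto simp: strip_def split_beta)
  with k have "reaches p (shift k q)" "reaches (shift k q) (shift 1 p)"
    by (auto simp: inside_def reaches_iff) (auto simp: shift_def)
  moreover from this(2) have "reaches q (shift (1 - k) p)"
    using reaches_shift [of k q "shift (1 - k) p"] by simp
  moreover have "\<not> same_orbit p q"
    using cr not_crosses_self [OF p] by (auto simp: same_orbit_def)
  ultimately show "\<not> same_orbit p q \<and> (\<exists>k. reaches p (shift k q)) \<and> (\<exists>k. reaches q (shift k p))"
    by blast
next
  assume "\<not> same_orbit p q \<and> (\<exists>k. reaches p (shift k q)) \<and> (\<exists>k. reaches q (shift k p))"
  then obtain j k where jk: "reaches p (shift j q)" "reaches q (shift k p)" "\<not> same_orbit p q"
    by blast
  have "reaches (shift j q) (shift (j + k) p)"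
    using jk(2) reaches_shift [of j q "shift k p"] by simp
  moreover have "p \<noteq> shift j q"
    using jk(3) same_orbit_sym same_orbit_shift by metis
  ultimately have "inside p (shift j q)"
    using reaches_reaches_inside [OF p _ jk(1)] q by simp
  then show "crosses p q"
    by (auto simp: crosses_def)
qed

section \<open>Dyadic arcs\<close>

text \<open>
  The ends of this arc are \<open>m\<pi>/2\<^sup>n\<close> and \<open>(m - 1)\<pi>/2\<^sup>n + 2\<pi>\<close>, so on the circle it is the interval
  \<open>[(m - 1)\<pi>/2\<^sup>n, m\<pi>/2\<^sup>n]\<close>.
\<close>

definition arc :: "nat \<Rightarrow> int \<Rightarrow> point" where
  "arc n m = (of_int m * pi / 2 ^ n, pi + (of_int m - 1) * pi / 2 ^ n)"

text \<open>The ends of the arc of \<open>p\<close> are measured in units of \<open>\<pi>/2\<^sup>n\<close>, so that a full turn is \<open>2\<^sup>n\<^sup>+\<^sup>1\<close>.\<close>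

definition left_end :: "nat \<Rightarrow> point \<Rightarrow> real" where
  "left_end n p = fst p * 2 ^ n / pi"

definition right_end :: "nat \<Rightarrow> point \<Rightarrow> real" where
  "right_end n p = (snd p + pi) * 2 ^ n / pi"

definition dyadic :: "nat \<Rightarrow> point \<Rightarrow> bool" where
  "dyadic n p \<longleftrightarrow> left_end n p \<in> \<int> \<and> right_end n p \<in> \<int>"

definition crosses_level :: "nat \<Rightarrow> point \<Rightarrow> bool" where
  "crosses_level n p \<longleftrightarrow> (\<exists>m. crosses p (arc n m))"

lemma width_arc: "snd (arc n m) - fst (arc n m) = pi - pi / 2 ^ n"
  by (simp add: arc_def field_simps)

lemma arc_in_strip: "arc n m \<in> strip"
proof -
  have "0 < pi / 2 ^ n" "pi / 2 ^ n \<le> pi"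
    by (simp_all add: field_simps)
  then have "\<bar>snd (arc n m) - fst (arc n m)\<bar> < pi"
    unfolding width_arc by linarith
  then show ?thesis
    by (simp add: strip_def split_beta)
qed

lemma shift_arc: "even k \<Longrightarrow> shift k (arc n m) = arc n (m + k * 2 ^ n)"
  by (simp add: shift_def arc_def field_simps)

lemma inside_arc:
  "inside p (arc n m) \<longleftrightarrow> of_int m - 1 < left_end n p \<and> left_end n p < of_int m \<and>
     of_int m < right_end n p \<and> right_end n p < of_int m - 1 + 2 ^ (n + 1)"
  by (auto simp: inside_def arc_def left_end_def right_end_def field_simps)

lemma inside_shift_arc:
  "inside p (shift (- 1) (arc n m)) \<longleftrightarrow> left_end n p < of_int m - 1 \<and> of_int m - 1 < right_end n p \<and>
     right_end n p < of_int m \<and> of_int m < left_end n p + 2 ^ (n + 1)"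
  by (auto simp: inside_def arc_def shift_def left_end_def right_end_def field_simps)

text \<open>
  All even shifts of an interval of level \<open>n\<close> are again among the \<open>arc n m\<close>. The two remaining cases are
  distinguished by which end of \<open>p\<close> lies in the interval: the left one in \<open>inside_arc\<close>, the right one in
  \<open>inside_shift_arc\<close>.
\<close>

lemma crosses_level_iff:
  "crosses_level n p \<longleftrightarrow> (\<exists>m. inside p (arc n m) \<or> inside p (shift (- 1) (arc n m)))"
proof
  assume "crosses_level n p"
  then obtain k m where km: "inside p (shift k (arc n m))"
    by (auto simp: crosses_level_def crosses_def)
  show "\<exists>m. inside p (arc n m) \<or> inside p (shift (- 1) (arc n m))"
  proof (cases "even k")
    case True
    with km show ?thesis
      by (auto simp: shift_arc)
  next
    case False
    then have "shift k (arc n m) = shift (- 1) (arc n (m + (k + 1) * 2 ^ n))"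
      by (simp flip: shift_arc)
    with km show ?thesis
      by auto
  qed
next
  assume "\<exists>m. inside p (arc n m) \<or> inside p (shift (- 1) (arc n m))"
  then show "crosses_level n p"
    unfolding crosses_level_def crosses_def by (metis shift_0)
qed

lemma crosses_level_same_orbit: "same_orbit p q \<Longrightarrow> crosses_level n p \<longleftrightarrow> crosses_level n q"
  unfolding crosses_level_def using crosses_same_orbit same_orbit_refl by blast

lemma left_end_Suc: "left_end (Suc n) p = 2 * left_end n p"
  and right_end_Suc: "right_end (Suc n) p = 2 * right_end n p"
  by (simp_all add: left_end_def right_end_def)

lemma left_end_add: "left_end (n + d) p = 2 ^ d * left_end n p"
  and right_end_add: "right_end (n + d) p = 2 ^ d * right_end n p"
  by (simp_all add: left_end_def right_end_def power_add)

lemma ends_difference: "right_end n p - left_end n p = (snd p + pi - fst p) / pi * 2 ^ n"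
  by (simp add: left_end_def right_end_def field_simps)

lemma ends_in_strip:
  assumes "p \<in> strip"
  shows "left_end n p < right_end n p" "right_end n p < left_end n p + 2 ^ (n + 1)"
proof -
  have "\<bar>snd p - fst p\<bar> < pi"
    using assms by (auto simp: strip_def)
  then have "0 < (snd p + pi - fst p) / pi" "(snd p + pi - fst p) / pi < 2"
    by (simp_all add: field_simps abs_less_iff)
  then have "0 * 2 ^ n < (snd p + pi - fst p) / pi * 2 ^ n"
    "(snd p + pi - fst p) / pi * 2 ^ n < 2 * 2 ^ n"
    by (auto simp only: mult_strict_right_mono zero_less_power zero_less_numeral)
  then show "left_end n p < right_end n p" "right_end n p < left_end n p + 2 ^ (n + 1)"
    unfolding ends_difference [symmetric] by simp_all
qed

lemma dyadic_mono: "dyadic n p \<Longrightarrow> n \<le> n' \<Longrightarrow> dyadic n' p"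
  by (auto simp: dyadic_def le_iff_add left_end_add right_end_add intro!: Ints_mult Ints_power)

lemma no_integer_between: "\<not> (of_int m - 1 < (of_int i :: real) \<and> (of_int i :: real) < of_int m)"
proof
  assume "of_int m - 1 < (of_int i :: real) \<and> (of_int i :: real) < of_int m"
  then have "real_of_int (m - 1) < of_int i" "real_of_int i < of_int m"
    by simp_all
  then show False
    unfolding of_int_less_iff by simp
qed

lemma dyadic_not_crosses_level:
  assumes "dyadic n p" "n \<le> n'"
  shows "\<not> crosses_level n' p"
proof -
  obtain i j where "left_end n' p = of_int i" "right_end n' p = of_int j"
    using dyadic_mono [OF assms] by (auto simp: dyadic_def elim!: Ints_cases)
  then show ?thesis
    unfolding crosses_level_iff inside_arc inside_shift_arc using no_integer_between by metis
qed

text \<open>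
  The ends of \<open>p\<close> divide the circle into pieces of lengths \<open>x\<pi>\<close> and \<open>(2 - x)\<pi>\<close>. Once \<open>\<pi>/2\<^sup>n\<close> is smaller than both,
  no interval of level \<open>n\<close> contains both ends, and a non-dyadic end is interior to the one around it.
\<close>

lemma not_dyadic_crosses_level:
  assumes p: "p \<in> strip" and nd: "\<And>n. \<not> dyadic n p"
  obtains n0 where "\<And>n. n0 \<le> n \<Longrightarrow> crosses_level n p"
proof -
  \<comment> \<open>the length of one of the two pieces, in units of \<open>\<pi>\<close>\<close>
  define x where "x = (snd p + pi - fst p) / pi"
  have ends: "right_end n p - left_end n p = x * 2 ^ n" for n
    by (simp add: x_def ends_difference)
  have x: "0 < x" "0 < 2 - x"
    using p by (auto simp: x_def strip_def field_simps abs_less_iff)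
  obtain n1 n2 where n12: "1 / x < 2 ^ n1" "1 / (2 - x) < 2 ^ n2"
    by (metis real_arch_pow one_less_numeral_iff semiring_norm(76))
  have "crosses_level n p" if n: "max n1 n2 \<le> n" for n
  proof -
    have "(2 :: real) ^ n1 \<le> 2 ^ n" "(2 :: real) ^ n2 \<le> 2 ^ n"
      using n by (simp_all add: power_increasing)
    with n12 have "1 / x < 2 ^ n" "1 / (2 - x) < 2 ^ n"
      by linarith+
    with x have big: "1 < right_end n p - left_end n p"
      "1 < 2 ^ (n + 1) - (right_end n p - left_end n p)"
      by (simp_all add: ends field_simps)
    have "left_end n p \<notin> \<int> \<or> right_end n p \<notin> \<int>"
      using nd [of n] by (simp add: dyadic_def)
    then show ?thesis
    proof
      assume "left_end n p \<notin> \<int>"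
      then have "inside p (arc n \<lceil>left_end n p\<rceil>)"
        unfolding inside_arc using big by (smt (verit) Ints_of_int ceiling_correct)
      then show ?thesis
        by (auto simp: crosses_level_iff)
    next
      assume "right_end n p \<notin> \<int>"
      then have "inside p (shift (- 1) (arc n \<lceil>right_end n p\<rceil>))"
        unfolding inside_shift_arc using big by (smt (verit) Ints_of_int ceiling_correct)
      then show ?thesis
        by (auto simp: crosses_level_iff)
    qed
  qed
  then show ?thesis
    by (rule that)
qed

lemma point_from_ends:
  assumes "left_end n p = of_int i" "right_end n p = of_int j"
  shows "p = (of_int i * pi / 2 ^ n, of_int j * pi / 2 ^ n - pi)"
  using assms by (auto simp: left_end_def right_end_def field_simps prod_eq_iff)

text \<open>
  In the first case the interval lies to the right of the left end of \<open>p\<close>, and \<open>p\<close> lists its ends in the other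
  order than \<open>arc\<close> does; hence the odd shift.
\<close>

lemma adjacent_ends_arc:
  assumes "left_end n p = of_int i" "right_end n p = of_int j"
    and "j = i + 1 \<or> j = i - 1 + 2 ^ (n + 1)"
  shows "\<exists>m. same_orbit p (arc n m)"
  using assms(3)
proof
  assume "j = i + 1"
  then have "p = shift (- 1) (arc n (i + 1))"
    by (subst point_from_ends [OF assms(1,2)]) (simp add: arc_def shift_def)
  then show ?thesis
    using same_orbit_sym same_orbit_shift by metis
next
  assume "j = i - 1 + 2 ^ (n + 1)"
  then have "real_of_int j = real_of_int i - 1 + 2 ^ (n + 1)"
    by simp
  then have "p = (of_int i * pi / 2 ^ n, (of_int i - 1 + 2 ^ (n + 1)) * pi / 2 ^ n - pi)"
    using point_from_ends [OF assms(1,2)] by simp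
  then have "p = arc n i"
    by (simp add: arc_def field_simps)
  then show ?thesis
    using same_orbit_refl by metis
qed

text \<open>
  The induction descends to the smallest level at which both ends are integers. There one end, say
  \<open>2 c + 1\<close>, is odd, and in the units of the level below it is the midpoint of the interval from \<open>c\<close> to \<open>c + 1\<close>. As this
  interval is not crossed, the other end is \<open>2 c\<close> or \<open>2 c + 2\<close> up to full turns. At level 0 a full turn is 2, so
  that two distinct ends are always neighbours.
\<close>

lemma dyadic_uncrossed_is_arc:
  assumes p: "p \<in> strip" and "dyadic n p" and uncrossed: "\<And>n. \<not> crosses_level n p"
  shows "\<exists>n m. same_orbit p (arc n m)"
  using assms(2)
proof (induction n)
  case 0
  then obtain i j where ij: "left_end 0 p = of_int i" "right_end 0 p = of_int j"
    by (auto simp: dyadic_def elim!: Ints_cases)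
  with ends_in_strip [OF p, of 0] have "j = i + 1"
    by simp
  with adjacent_ends_arc [OF ij] show ?case
    by blast
next
  case (Suc n)
  then obtain i j where ij: "left_end (Suc n) p = of_int i" "right_end (Suc n) p = of_int j"
    by (auto simp: dyadic_def elim!: Ints_cases)
  then have half: "left_end n p = of_int i / 2" "right_end n p = of_int j / 2"
    by (simp_all add: left_end_Suc right_end_Suc)
  have "real_of_int i < real_of_int j" "real_of_int j < real_of_int (i + 2 ^ (Suc n + 1))"
    using ends_in_strip [OF p, of "Suc n"] ij by simp_all
  then have bounds: "i < j" "j < i + 2 ^ (n + 2)"
    unfolding of_int_less_iff by simp_all
  consider "even i" "even j" | c where "i = 2 * c + 1" | c where "j = 2 * c + 1"
    by (meson oddE)
  then show ?case
  proof cases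
    case 1
    then have "dyadic n p"
      using half by (auto simp: dyadic_def elim!: evenE)
    then show ?thesis
      by (rule Suc.IH)
  next
    case 2
    have "\<not> inside p (arc n (c + 1))"
      using uncrossed [of n] by (auto simp: crosses_level_iff)
    then have "\<not> (real_of_int (2 * (c + 1)) < of_int j \<and> real_of_int j < of_int (2 * c + 2 ^ (n + 2)))"
      using 2 unfolding inside_arc half by (simp add: field_simps)
    then have "\<not> (2 * (c + 1) < j \<and> j < 2 * c + 2 ^ (n + 2))"
      unfolding of_int_less_iff .
    with bounds 2 have "j = i + 1 \<or> j = i - 1 + 2 ^ (Suc n + 1)"
      by auto
    with adjacent_ends_arc [OF ij] show ?thesis
      by blast
  next
    case 3
    have "\<not> inside p (shift (- 1) (arc n (c + 1)))"
      using uncrossed [of n] by (auto simp: crosses_level_iff)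
    then have "\<not> (real_of_int i < of_int (2 * c) \<and> real_of_int (2 * (c + 1)) < of_int (i + 2 ^ (n + 2)))"
      using 3 unfolding inside_shift_arc half by (simp add: field_simps)
    then have "\<not> (i < 2 * c \<and> 2 * (c + 1) < i + 2 ^ (n + 2))"
      unfolding of_int_less_iff .
    with bounds 3 have "j = i + 1 \<or> j = i - 1 + 2 ^ (Suc n + 1)"
      by auto
    with adjacent_ends_arc [OF ij] show ?thesis
      by blast
  qed
qed

lemma left_end_arc: "left_end n (arc n m) = of_int m"
  and right_end_arc: "right_end n (arc n m) = of_int (m - 1 + 2 ^ (n + 1))"
  by (simp_all add: left_end_def right_end_def arc_def field_simps)

text \<open>
  For \<open>n \<le> n'\<close> the ends of \<open>arc n m\<close> are integers at level \<open>n'\<close>. For \<open>n' < n\<close> the arc is shorter than the intervals of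
  level \<open>n'\<close>, and crossing one of them would put an end point of it, a multiple \<open>D c\<close> of \<open>D = 2 ^ (n - n')\<close> in
  the units of level \<open>n\<close>, strictly between \<open>m - 1\<close> and \<open>m\<close>.
\<close>

lemma arc_not_crosses_level: "\<not> crosses_level n' (arc n m)"
proof (cases "n \<le> n'")
  case True
  then show ?thesis
    using dyadic_not_crosses_level [of n "arc n m" n']
    by (simp add: dyadic_def left_end_arc right_end_arc del: of_int_add of_int_diff of_int_power)
next
  case False
  define D :: int where "D = 2 ^ (n - n')"
  have D: "0 < D"
    by (simp add: D_def)
  have n: "n = n' + (n - n')"
    using False by simp
  have l: "of_int m = of_int D * left_end n' (arc n m)"
    using left_end_arc [of n m] left_end_add [of n' "n - n'" "arc n m"] n by (simp add: D_def)
  have r: "of_int (m - 1) = of_int D * (right_end n' (arc n m) - 2 ^ (n' + 1))"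
    using right_end_arc [of n m] right_end_add [of n' "n - n'" "arc n m"] n
      power_add [of "2 :: real" "n - n'" n']
    by (simp add: D_def algebra_simps)
  have less: "u < v \<longleftrightarrow> of_int D * u < of_int D * v" for u v :: real
    using D by simp
  show ?thesis
  proof
    assume "crosses_level n' (arc n m)"
    then obtain m' where
      "(of_int (m' - 1) < left_end n' (arc n m) \<and>
         right_end n' (arc n m) - 2 ^ (n' + 1) < of_int (m' - 1)) \<or>
       (right_end n' (arc n m) - 2 ^ (n' + 1) < of_int (m' - 2 ^ (n' + 1)) \<and>
         of_int (m' - 2 ^ (n' + 1)) < left_end n' (arc n m))"
      by (auto simp: crosses_level_iff inside_arc inside_shift_arc algebra_simps)
    then obtain c :: int where "of_int c < left_end n' (arc n m)"
      "right_end n' (arc n m) - 2 ^ (n' + 1) < of_int c"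
      by blast
    then have "of_int (D * c) < real_of_int m" "real_of_int (m - 1) < of_int (D * c)"
      unfolding l r of_int_mult using D by simp_all
    then show False
      unfolding of_int_less_iff by simp
  qed
qed


section \<open>Supports\<close>

lemma standard_cluster_eq:
  "standard_cluster =
     {M (fst (arc n m)) (snd (arc n m)) |n m. 0 \<le> m \<and> m < 2 ^ (n + 1) \<and> (n, m) \<noteq> (0, 1)}"
proof (intro equalityI subsetI)
  fix S
  assume "S \<in> standard_cluster"
  then obtain m n where S: "S = M (real m * pi / 2 ^ n) (pi + (real m - 1) * pi / 2 ^ n)"
    and m: "m < 2 ^ (n + 1)" "(m, n) \<noteq> (1, 0)"
    unfolding standard_cluster_def by blast
  have "S = M (fst (arc n (int m))) (snd (arc n (int m)))"
    by (simp add: S arc_def)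
  moreover have "int m < int (2 ^ (n + 1))"
    unfolding of_nat_less_iff by (rule m)
  then have "int m < 2 ^ (n + 1)"
    by simp
  moreover have "(n, int m) \<noteq> (0, 1)"
    using m(2) by auto
  ultimately show "S \<in> {M (fst (arc n m)) (snd (arc n m)) |n m.
      0 \<le> m \<and> m < 2 ^ (n + 1) \<and> (n, m) \<noteq> (0, 1)}"
    by (intro CollectI exI [of _ n] exI [of _ "int m"] conjI) simp_all
next
  fix S
  assume "S \<in> {M (fst (arc n m)) (snd (arc n m)) |n m.
      0 \<le> m \<and> m < 2 ^ (n + 1) \<and> (n, m) \<noteq> (0, 1)}"
  then obtain n m where S: "S = M (fst (arc n m)) (snd (arc n m))"
    and m: "0 \<le> m" "m < 2 ^ (n + 1)" "(n, m) \<noteq> (0, 1)"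
    by blast
  have "S = M (real (nat m) * pi / 2 ^ n) (pi + (real (nat m) - 1) * pi / 2 ^ n)"
    using m(1) by (simp add: S arc_def)
  moreover have "nat m < 2 ^ (n + 1)"
    using m(1,2) by (simp add: nat_less_iff)
  moreover have "(nat m, n) \<noteq> (1, 0)"
    using m(1,3) by auto
  ultimately show "S \<in> standard_cluster"
    unfolding standard_cluster_def by blast
qed

lemma standard_cluster_arc:
  assumes "S \<in> standard_cluster"
  obtains n m where "same_orbit (arc n m) (position S)"
proof -
  obtain n m where "S = M (fst (arc n m)) (snd (arc n m))"
    using assms unfolding standard_cluster_eq by blast
  then show ?thesis
    using that position_M [of "fst (arc n m)" "snd (arc n m)"] by simp
qed

text \<open>
  Translation by a full turn brings \<open>m\<close> into the range \<open>0 \<le> m < 2\<^sup>n\<^sup>+\<^sup>1\<close>. On the circle, the half circles \<open>arc 0 1\<close>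
  and \<open>arc 0 0\<close> have the same ends.
\<close>

lemma arc_standard_cluster: "\<exists>S\<in>standard_cluster. same_orbit (arc n m) (position S)"
proof -
  have reduced: "\<exists>S\<in>standard_cluster. same_orbit (arc n m) (position S)"
    if "0 \<le> m" "m < 2 ^ (n + 1)" "(n, m) \<noteq> (0, 1)" for n m
    using position_M [of "fst (arc n m)" "snd (arc n m)"] that
    unfolding standard_cluster_eq by auto
  define m' :: int where "m' = m mod 2 ^ (n + 1)"
  have "m' = m + (- 2 * (m div 2 ^ (n + 1))) * 2 ^ n"
    using minus_div_mult_eq_mod [of m "2 ^ (n + 1)"] by (simp add: m'_def)
  then have m': "same_orbit (arc n m) (arc n m')"
    using same_orbit_shift [of "arc n m" "- 2 * (m div 2 ^ (n + 1))"] by (simp add: shift_arc)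
  have bounds: "0 \<le> m'" "m' < 2 ^ (n + 1)"
    by (simp_all add: m'_def)
  show ?thesis
  proof (cases "(n, m') = (0, 1)")
    case True
    have "arc 0 0 = shift (- 1) (arc 0 1)"
      by (simp add: arc_def shift_def)
    then have "same_orbit (arc 0 1) (arc 0 0)"
      by (metis same_orbit_shift)
    moreover have "same_orbit (arc n m) (arc 0 1)"
      using m' True by simp
    ultimately have "same_orbit (arc n m) (arc 0 0)"
      using same_orbit_trans by blast
    moreover have "\<exists>S\<in>standard_cluster. same_orbit (arc 0 0) (position S)"
      by (rule reduced) auto
    ultimately show ?thesis
      using same_orbit_trans by blast
  next
    case False
    then show ?thesis
      using reduced [OF bounds] m' same_orbit_trans by blast
  qed
qed

lemma standard_cluster_subset: "standard_cluster \<subseteq> indecomposables"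
proof -
  have "M (fst (arc n m)) (snd (arc n m)) \<in> indecomposables" for n m
    using arc_in_strip [of n m] by (simp add: M_in_indecomposables)
  then show ?thesis
    unfolding standard_cluster_eq by blast
qed

lemma support_ind_eq:
  assumes U: "U \<in> indecomposables"
  shows "support_ind TYPE('k::field) U = {S \<in> standard_cluster. crosses (position U) (position S)}"
proof -
  have "(\<not> isomorphic (cluster_ind :: (cobj, 'k, int \<Rightarrow> 'k set) lincat) S U \<and>
      hom_nonzero (cluster_ind :: (cobj, 'k, int \<Rightarrow> 'k set) lincat) S U \<and>
      hom_nonzero (cluster_ind :: (cobj, 'k, int \<Rightarrow> 'k set) lincat) U S) \<longleftrightarrow>
      crosses (position U) (position S)" if "S \<in> standard_cluster" for S
  proof -
    have S: "S \<in> indecomposables"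
      using that standard_cluster_subset by blast
    show ?thesis
      using crosses_iff [OF position_in_strip [OF U] position_in_strip [OF S]] same_orbit_sym
      unfolding isomorphic_cluster_ind [OF S U] hom_nonzero_cluster_ind [OF S U]
        hom_nonzero_cluster_ind [OF U S] by blast
  qed
  then show ?thesis
    unfolding support_ind_def Let_def by blast
qed

lemma crosses_level_iff_standard_cluster:
  "(\<exists>n. crosses_level n p) \<longleftrightarrow> (\<exists>S\<in>standard_cluster. crosses p (position S))"
  unfolding crosses_level_def
  using standard_cluster_arc arc_standard_cluster crosses_same_orbit same_orbit_refl by metis

lemma uncrossed_iff_arc:
  assumes p: "p \<in> strip"
  shows "(\<forall>n. \<not> crosses_level n p) \<longleftrightarrow> (\<exists>n m. same_orbit p (arc n m))"
proof
  assume uncrossed: "\<forall>n. \<not> crosses_level n p"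
  then obtain n where "dyadic n p"
    using not_dyadic_crosses_level [OF p] by (metis order_refl)
  with uncrossed show "\<exists>n m. same_orbit p (arc n m)"
    using dyadic_uncrossed_is_arc [OF p] by blast
next
  assume "\<exists>n m. same_orbit p (arc n m)"
  then show "\<forall>n. \<not> crosses_level n p"
    using arc_not_crosses_level crosses_level_same_orbit by blast
qed

lemma support_ind_empty_iff:
  assumes U: "U \<in> indecomposables"
  shows "support_ind TYPE('k::field) U = {} \<longleftrightarrow>
           (\<exists>S\<in>standard_cluster. same_orbit (position U) (position S))"
proof -
  have "support_ind TYPE('k) U = {} \<longleftrightarrow> (\<forall>n. \<not> crosses_level n (position U))"
    using crosses_level_iff_standard_cluster [of "position U"] by (auto simp: support_ind_eq [OF U])
  also have "\<dots> \<longleftrightarrow> (\<exists>n m. same_orbit (position U) (arc n m))"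
    by (rule uncrossed_iff_arc [OF position_in_strip [OF U]])
  also have "\<dots> \<longleftrightarrow> (\<exists>S\<in>standard_cluster. same_orbit (position U) (position S))"
    using standard_cluster_arc arc_standard_cluster same_orbit_trans same_orbit_sym by metis
  finally show ?thesis .
qed

text \<open>An invariant of orbits that tells apart intervals of different levels.\<close>

lemma width_same_orbit: "same_orbit p q \<Longrightarrow> \<bar>snd p - fst p\<bar> = \<bar>snd q - fst q\<bar>"
  by (auto simp: same_orbit_def shift_def)

text \<open>
  An arc that is dyadic of level \<open>N\<close> crosses intervals of levels below \<open>N\<close> only, and each level has
  finitely many of them. An arc that is not dyadic crosses some interval of each large level, and intervals of
  different levels are different objects.
\<close>

lemma support_ind_finite_iff:
  assumes U: "U \<in> indecomposables"
  shows "finite (support_ind TYPE('k::field) U) \<longleftrightarrow> (\<exists>n. dyadic n (position U))"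
proof
  assume "\<exists>n. dyadic n (position U)"
  then obtain N where N: "dyadic N (position U)" ..
  let ?I = "SIGMA n:{..<N}. {0::int..<2 ^ (n + 1)}"
  have "support_ind TYPE('k) U \<subseteq> (\<lambda>(n, m). M (fst (arc n m)) (snd (arc n m))) ` ?I"
  proof
    fix S
    assume "S \<in> support_ind TYPE('k) U"
    then have S: "S \<in> standard_cluster" "crosses (position U) (position S)"
      by (auto simp: support_ind_eq [OF U])
    then obtain n m where nm: "S = M (fst (arc n m)) (snd (arc n m))" "0 \<le> m" "m < 2 ^ (n + 1)"
      unfolding standard_cluster_eq by blast
    have "crosses (position U) (arc n m)"
      using S(2) nm(1) position_M [of "fst (arc n m)" "snd (arc n m)"]
        crosses_same_orbit same_orbit_refl by (metis prod.collapse)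
    then have "n < N"
      using dyadic_not_crosses_level [OF N, of n] by (auto simp: crosses_level_def not_le [symmetric])
    with nm show "S \<in> (\<lambda>(n, m). M (fst (arc n m)) (snd (arc n m))) ` ?I"
      by (intro image_eqI [of _ _ "(n, m)"]) auto
  qed
  then show "finite (support_ind TYPE('k) U)"
    by (rule finite_subset) auto
next
  assume fin: "finite (support_ind TYPE('k) U)"
  show "\<exists>n. dyadic n (position U)"
  proof (rule ccontr)
    assume "\<not> ?thesis"
    then obtain n0 where n0: "\<And>n. n0 \<le> n \<Longrightarrow> crosses_level n (position U)"
      using not_dyadic_crosses_level [OF position_in_strip [OF U]] by blast
    have "\<exists>S\<in>support_ind TYPE('k) U. \<exists>m. same_orbit (arc n m) (position S)" if n: "n0 \<le> n" for n
    proof -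
      obtain m where m: "crosses (position U) (arc n m)"
        using n0 [OF n] by (auto simp: crosses_level_def)
      obtain S where "S \<in> standard_cluster" "same_orbit (arc n m) (position S)"
        using arc_standard_cluster by blast
      then show ?thesis
        using m crosses_same_orbit [of "position U" "position U" "arc n m" "position S"]
        by (auto simp: support_ind_eq [OF U])
    qed
    then obtain S where S: "\<And>n. n0 \<le> n \<Longrightarrow> S n \<in> support_ind TYPE('k) U"
      "\<And>n. n0 \<le> n \<Longrightarrow> \<exists>m. same_orbit (arc n m) (position (S n))"
      by metis
    have width: "\<bar>snd (position (S n)) - fst (position (S n))\<bar> = \<bar>pi - pi / 2 ^ n\<bar>" if "n0 \<le> n" for n
      using S(2) [OF that] width_same_orbit width_arc by metis
    have "inj_on S {n0..}"
    proof (rule inj_onI)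
      fix i j
      assume "i \<in> {n0..}" "j \<in> {n0..}" "S i = S j"
      then have "\<bar>pi - pi / 2 ^ i\<bar> = \<bar>pi - pi / 2 ^ j\<bar>"
        using width by (metis atLeast_iff)
      moreover have "pi / 2 ^ i \<le> pi" "pi / 2 ^ j \<le> pi"
        by (simp_all add: field_simps)
      ultimately have "(2 :: real) ^ i = 2 ^ j"
        by (simp add: field_simps)
      then show "i = j"
        by simp
    qed
    moreover have "S ` {n0..} \<subseteq> support_ind TYPE('k) U"
      using S by auto
    ultimately have "finite {n0..}"
      using fin inj_on_finite by blast
    then show False
      by (simp add: infinite_Ici)
  qed
qed

lemma dyadic_shift [simp]: "dyadic n (shift k p) \<longleftrightarrow> dyadic n p"
proof -
  have dyadic: "dyadic n (shift k p)" if "dyadic n p" for k p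
  proof -
    have "left_end n (shift k p) = left_end n p + of_int k * 2 ^ n \<and>
        right_end n (shift k p) = right_end n p + of_int k * 2 ^ n" if "even k"
      using that by (simp add: left_end_def right_end_def shift_def field_simps)
    moreover have "left_end n (shift k p) = right_end n p + of_int (k - 1) * 2 ^ n \<and>
        right_end n (shift k p) = left_end n p + of_int (k + 1) * 2 ^ n" if "odd k"
      using that by (simp add: left_end_def right_end_def shift_def field_simps)
    ultimately show ?thesis
      using that unfolding dyadic_def
      by (cases "even k") (simp_all del: of_int_add of_int_diff)
  qed
  show ?thesis
    using dyadic [of p k] dyadic [of "shift k p" "- k"] by auto
qed

lemma rational_objects_eq: "rational_objects = {M (fst p) (snd p) |p n. p \<in> strip \<and> dyadic n p}"
proof (intro equalityI subsetI)
  fix V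
  assume "V \<in> rational_objects"
  then obtain a b :: int and n :: nat where
    V: "V = M (of_int a * pi / 2 ^ n) (of_int b * pi / 2 ^ n)" and ab: "\<bar>a - b\<bar> < 2 ^ n"
    unfolding rational_objects_def by blast
  define p where "p = (of_int a * pi / 2 ^ n, of_int b * pi / 2 ^ n)"
  have "left_end n p = of_int a" "right_end n p = of_int (b + 2 ^ n)"
    by (simp_all add: p_def left_end_def right_end_def field_simps)
  then have "dyadic n p"
    by (simp add: dyadic_def del: of_int_add of_int_power)
  moreover have "p \<in> strip"
  proof -
    have "real_of_int \<bar>a - b\<bar> < of_int (2 ^ n)"
      unfolding of_int_less_iff by (rule ab)
    then have "\<bar>real_of_int b - of_int a\<bar> * pi < 2 ^ n * pi"
      by (intro mult_strict_right_mono) auto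
    then have "\<bar>real_of_int b - of_int a\<bar> * pi / 2 ^ n < pi"
      by (simp add: field_simps)
    moreover have "snd p - fst p = (of_int b - of_int a) * pi / 2 ^ n"
      by (simp add: p_def field_simps)
    ultimately show ?thesis
      by (simp add: strip_def split_beta abs_mult)
  qed
  ultimately show "V \<in> {M (fst p) (snd p) |p n. p \<in> strip \<and> dyadic n p}"
    using V by (intro CollectI exI [of _ p] exI [of _ n]) (simp add: p_def)
next
  fix V
  assume "V \<in> {M (fst p) (snd p) |p n. p \<in> strip \<and> dyadic n p}"
  then obtain p n where V: "V = M (fst p) (snd p)" and p: "p \<in> strip" and "dyadic n p"
    by blast
  then obtain i j where ij: "left_end n p = of_int i" "right_end n p = of_int j"
    by (auto simp: dyadic_def elim!: Ints_cases)
  have "p = (of_int i * pi / 2 ^ n, of_int (j - 2 ^ n) * pi / 2 ^ n)"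
    using point_from_ends [OF ij] by (simp add: field_simps)
  moreover have "\<bar>i - (j - 2 ^ n)\<bar> < 2 ^ n"
  proof -
    have "real_of_int i < of_int j" "real_of_int j < of_int (i + 2 ^ (n + 1))"
      using ends_in_strip [OF p, of n] ij by simp_all
    then have "i < j" "j < i + 2 ^ (n + 1)"
      unfolding of_int_less_iff .
    then show ?thesis
      by simp
  qed
  ultimately show "V \<in> rational_objects"
    unfolding rational_objects_def V by (metis (mono_tags, lifting) fst_conv snd_conv mem_Collect_eq)
qed

lemma rational_objects_subset: "rational_objects \<subseteq> indecomposables"
  by (auto simp: rational_objects_eq M_in_indecomposables)

lemma dyadic_iff_rational_object:
  assumes p: "p \<in> strip"
  shows "(\<exists>n. dyadic n p) \<longleftrightarrow> (\<exists>V\<in>rational_objects. same_orbit p (position V))"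
proof
  assume "\<exists>n. dyadic n p"
  then have "M (fst p) (snd p) \<in> rational_objects"
    using p unfolding rational_objects_eq by blast
  then show "\<exists>V\<in>rational_objects. same_orbit p (position V)"
    using position_M [of "fst p" "snd p"] by auto
next
  assume "\<exists>V\<in>rational_objects. same_orbit p (position V)"
  then obtain q n where "same_orbit p (position (M (fst q) (snd q)))" "dyadic n q"
    unfolding rational_objects_eq by blast
  moreover from this have "same_orbit q p"
    using position_M [of "fst q" "snd q"] same_orbit_trans same_orbit_sym by (metis prod.collapse)
  ultimately show "\<exists>n. dyadic n p"
    by (auto simp: same_orbit_def)
qed

theorem proposition2p2p7:
  fixes X :: "cobj list"
  assumes "X \<in> Obj (cluster_cat :: (cobj list, 'k::field, (int \<Rightarrow> 'k set) list list) lincat)"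
  shows "(X \<in> add_standard_cluster TYPE('k) \<longleftrightarrow> support TYPE('k) X = {}) \<and>
         (finite (support TYPE('k) X) \<longleftrightarrow>
          X \<in> Obj (X_cat :: (cobj list, 'k, (int \<Rightarrow> 'k set) list list) lincat))"
proof
  have X: "set X \<subseteq> indecomposables"
    using assms by (simp add: cluster_cat_def additive_closure_def Obj_cluster_ind)
  have "X \<in> add_standard_cluster TYPE('k) \<longleftrightarrow>
      (\<forall>U\<in>set X. \<exists>S\<in>standard_cluster. same_orbit (position U) (position S))"
    using X by (simp add: add_standard_cluster_def add_generated_cluster_ind standard_cluster_subset)
  also have "\<dots> \<longleftrightarrow> (\<forall>U\<in>set X. support_ind TYPE('k) U = {})"
    using X by (auto simp: support_ind_empty_iff subset_iff)
  also have "\<dots> \<longleftrightarrow> support TYPE('k) X = {}"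
    by (simp add: support_def)
  finally show "X \<in> add_standard_cluster TYPE('k) \<longleftrightarrow> support TYPE('k) X = {}" .
  have "finite (support TYPE('k) X) \<longleftrightarrow> (\<forall>U\<in>set X. finite (support_ind TYPE('k) U))"
    by (simp add: support_def)
  also have "\<dots> \<longleftrightarrow> (\<forall>U\<in>set X. \<exists>V\<in>rational_objects. same_orbit (position U) (position V))"
    using X position_in_strip
    by (auto simp: support_ind_finite_iff dyadic_iff_rational_object subset_iff)
  also have "\<dots> \<longleftrightarrow> X \<in> Obj (X_cat :: (cobj list, 'k, (int \<Rightarrow> 'k set) list list) lincat)"
    using X assms
    by (simp add: X_cat_def full_subcat_def add_generated_cluster_ind rational_objects_subset)
  finally show "finite (support TYPE('k) X) \<longleftrightarrow>
      X \<in> Obj (X_cat :: (cobj list, 'k, (int \<Rightarrow> 'k set) list list) lincat)" .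
qed

end
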